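(* Let $d\ge 1$ be an integer. Every $d(d+1)$-connected graph is rigid in $\mathbb{R}^d$.
   Context: A $d$-dimensional framework is a pair $(G,p)$ with $G=(V,E)$ a graph and $p:V\to\mathbb{R}^d$. Frameworks $(G,p)$ and $(G,q)$ are equivalent if $\|p(u)-p(v)\|=\|q(u)-q(v)\|$ for all $uv\in E$, and congruent if this holds for all $u,v\in V$. $(G,p)$ is rigid if there is $\varepsilon>0$ such that every equivalent $(G,q)$ with $\|p(v)-q(v)\|<\varepsilon$ for all $v$ is congruent to $(G,p)$. A framework is generic if its $d|V|$ coordinates are algebraically independent over $\mathbb{Q}$. A graph is rigid in $\mathbb{R}^d$ if some (equivalently, every) generic $d$-dimensional framework of it is rigid. *)

theory Defs
  imports
    "HOL-Analysis.Analysis"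
    "HOL-Library.Poly_Mapping"
    "Graph_Theory.Digraph_Component"
begin

text \<open>
  A finite simple graph is a \<open>pair_graph\<close>: a finite, loop-free, symmetric set \<open>parcs G\<close> of
  ordered pairs, an undirected edge \<open>uv\<close> being represented by both \<open>(u,v)\<close> and \<open>(v,u)\<close>.
  A framework is a function \<open>p\<close> on the whole vertex type; only its values on \<open>pverts G\<close> matter.
\<close>

definition k_connected :: "nat \<Rightarrow> 'a pair_pre_digraph \<Rightarrow> bool" where
  "k_connected k G \<longleftrightarrow>
     card (pverts G) > k \<and>
     (\<forall>S \<subseteq> pverts G. card S < k \<longrightarrow>
        Digraph_Component.connected (with_proj G \<restriction> (pverts G - S)))"

definition equivalent_frameworks ::
  "'a pair_pre_digraph \<Rightarrow> ('a \<Rightarrow> real ^ 'd) \<Rightarrow> ('a \<Rightarrow> real ^ 'd) \<Rightarrow> bool" where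
  "equivalent_frameworks G p q \<longleftrightarrow>
     (\<forall>(u, v) \<in> parcs G. norm (p u - p v) = norm (q u - q v))"

definition congruent_frameworks ::
  "'a pair_pre_digraph \<Rightarrow> ('a \<Rightarrow> real ^ 'd) \<Rightarrow> ('a \<Rightarrow> real ^ 'd) \<Rightarrow> bool" where
  "congruent_frameworks G p q \<longleftrightarrow>
     (\<forall>u \<in> pverts G. \<forall>v \<in> pverts G. norm (p u - p v) = norm (q u - q v))"

definition rigid_framework :: "'a pair_pre_digraph \<Rightarrow> ('a \<Rightarrow> real ^ 'd) \<Rightarrow> bool" where
  "rigid_framework G p \<longleftrightarrow>
     (\<exists>\<epsilon>>0. \<forall>q. equivalent_frameworks G p q \<and> (\<forall>v \<in> pverts G. norm (p v - q v) < \<epsilon>)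
        \<longrightarrow> congruent_frameworks G p q)"

text \<open>
  Polynomials over the rationals in variables indexed by \<open>'i\<close> are finitely supported maps from
  monomials (finitely supported exponent vectors \<open>'i \<Rightarrow>\<^sub>0 nat\<close>) to coefficients.
\<close>

definition rat_mpoly_eval :: "('i \<Rightarrow> real) \<Rightarrow> (('i \<Rightarrow>\<^sub>0 nat) \<Rightarrow>\<^sub>0 rat) \<Rightarrow> real" where
  "rat_mpoly_eval x P =
     (\<Sum>m \<in> Poly_Mapping.keys P. of_rat (Poly_Mapping.lookup P m) *
        (\<Prod>i \<in> Poly_Mapping.keys m. x i ^ Poly_Mapping.lookup m i))"

definition algebraically_independent_over_rat :: "'i set \<Rightarrow> ('i \<Rightarrow> real) \<Rightarrow> bool" where
  "algebraically_independent_over_rat I x \<longleftrightarrow>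
     (\<forall>P. (\<forall>m \<in> Poly_Mapping.keys P. Poly_Mapping.keys m \<subseteq> I) \<and>
        rat_mpoly_eval x P = 0 \<longrightarrow> P = 0)"

definition generic_framework :: "'a pair_pre_digraph \<Rightarrow> ('a \<Rightarrow> real ^ 'd) \<Rightarrow> bool" where
  "generic_framework G p \<longleftrightarrow>
     algebraically_independent_over_rat (pverts G \<times> UNIV) (\<lambda>(v, i). p v $ i)"

text \<open>The type argument fixes the ambient space \<open>real ^ 'd\<close>, of dimension \<open>CARD('d)\<close>.\<close>

definition rigid_graph :: "'d::finite itself \<Rightarrow> 'a pair_pre_digraph \<Rightarrow> bool" where
  "rigid_graph (_ :: 'd itself) G \<longleftrightarrow>
     (\<exists>p :: 'a \<Rightarrow> real ^ 'd. generic_framework G p \<and> rigid_framework G p)"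

end

theory Submission
  imports Defs
begin

text \<open>
  Place the vertices at algebraically independent coordinates \<open>p\<close>, and add to the graph all pairs
  whose distance is preserved to first order by every infinitesimal motion. The claim becomes that
  such a closed, \<open>d(d+1)\<close>-connected graph is complete. Let \<open>r(S)\<close> be the rank of the rigidity matrix
  of the subgraph induced by \<open>S\<close>. Inserting a vertex with \<open>m\<close> neighbours in \<open>S\<close> raises \<open>r\<close> by at least
  \<open>min d m\<close>, and by at least \<open>d + 1\<close> if \<open>m > d\<close> and these neighbours are not a clique. Insert the
  vertices in a uniformly random order. A vertex of degree \<open>k \<ge> d(d+1)\<close> whose neighbourhood is not a
  clique then contributes at least \<open>d\<close> on average, because in a closed graph two cliques sharing
  \<open>d\<close> vertices have a clique as union, so that a random \<open>i\<close>-subset of the neighbourhood fails to be a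
  clique with probability at least \<open>i / k\<close> for \<open>i > d\<close>. If this held at all vertices, the rank would be
  at least \<open>d |V|\<close>, which the translations forbid. Hence some vertex has a clique as neighbourhood, and
  deleting it preserves the connectivity, which allows induction.
\<close>

section \<open>Rational polynomial functions and algebraic independence\<close>

definition mono_eval :: "('i \<Rightarrow> real) \<Rightarrow> ('i \<Rightarrow>\<^sub>0 nat) \<Rightarrow> real" where
  "mono_eval x m = (\<Prod>i \<in> Poly_Mapping.keys m. x i ^ Poly_Mapping.lookup m i)"

lemma mono_eval_superset:
  assumes "finite J" "Poly_Mapping.keys m \<subseteq> J"
  shows "mono_eval x m = (\<Prod>i \<in> J. x i ^ Poly_Mapping.lookup m i)"
  unfolding mono_eval_def
  using assms by (intro prod.mono_neutral_left) (auto simp: in_keys_iff)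

lemma mono_eval_add: "mono_eval x (m + n) = mono_eval x m * mono_eval x n"
proof -
  let ?J = "Poly_Mapping.keys m \<union> Poly_Mapping.keys n"
  have "mono_eval x (m + n) = (\<Prod>i \<in> ?J. x i ^ Poly_Mapping.lookup (m + n) i)"
    by (intro mono_eval_superset) (simp_all add: keys_add)
  also have "\<dots> = (\<Prod>i \<in> ?J. x i ^ Poly_Mapping.lookup m i) * (\<Prod>i \<in> ?J. x i ^ Poly_Mapping.lookup n i)"
    by (simp add: lookup_add power_add prod.distrib)
  also have "\<dots> = mono_eval x m * mono_eval x n"
    by (simp add: mono_eval_superset[of ?J])
  finally show ?thesis .
qed

lemma rat_mpoly_eval_superset:
  assumes "finite M" "Poly_Mapping.keys P \<subseteq> M"
  shows "rat_mpoly_eval x P = (\<Sum>m \<in> M. of_rat (Poly_Mapping.lookup P m) * mono_eval x m)"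
  unfolding rat_mpoly_eval_def mono_eval_def[symmetric]
  using assms by (intro sum.mono_neutral_left) (auto simp: in_keys_iff)

lemma rat_mpoly_eval_0 [simp]: "rat_mpoly_eval x 0 = 0"
  by (simp add: rat_mpoly_eval_def)

lemma rat_mpoly_eval_single: "rat_mpoly_eval x (Poly_Mapping.single m c) = of_rat c * mono_eval x m"
  by (simp add: rat_mpoly_eval_superset[of "{m}"])

lemma rat_mpoly_eval_add: "rat_mpoly_eval x (P + Q) = rat_mpoly_eval x P + rat_mpoly_eval x Q"
proof -
  let ?M = "Poly_Mapping.keys P \<union> Poly_Mapping.keys Q"
  have "rat_mpoly_eval x (P + Q) = (\<Sum>m \<in> ?M. of_rat (Poly_Mapping.lookup (P + Q) m) * mono_eval x m)"
    by (intro rat_mpoly_eval_superset) (simp_all add: keys_add)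
  then show ?thesis
    by (simp add: lookup_add of_rat_add distrib_right sum.distrib rat_mpoly_eval_superset[of ?M])
qed

lemma rat_mpoly_eval_sum:
  "rat_mpoly_eval x (\<Sum>a\<in>A. f a) = (\<Sum>a\<in>A. rat_mpoly_eval x (f a))"
  by (induction A rule: infinite_finite_induct) (auto simp: rat_mpoly_eval_add)

lemma sum_single_lookup:
  "(\<Sum>m\<in>Poly_Mapping.keys P. Poly_Mapping.single m (Poly_Mapping.lookup P m)) = P"
proof (rule poly_mapping_eqI)
  fix k
  have "Poly_Mapping.lookup (\<Sum>m\<in>Poly_Mapping.keys P. Poly_Mapping.single m (Poly_Mapping.lookup P m)) k
      = (\<Sum>m\<in>Poly_Mapping.keys P. if m = k then Poly_Mapping.lookup P m else 0)"
    by (simp add: lookup_sum lookup_single when_def)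
  also have "\<dots> = Poly_Mapping.lookup P k"
    by (simp add: in_keys_iff)
  finally show "Poly_Mapping.lookup (\<Sum>m\<in>Poly_Mapping.keys P. Poly_Mapping.single m (Poly_Mapping.lookup P m)) k
      = Poly_Mapping.lookup P k" .
qed

lemma rat_mpoly_eval_mult: "rat_mpoly_eval x (P * Q) = rat_mpoly_eval x P * rat_mpoly_eval x Q"
proof -
  have "P * Q = (\<Sum>m\<in>Poly_Mapping.keys P. Poly_Mapping.single m (Poly_Mapping.lookup P m)) *
                (\<Sum>n\<in>Poly_Mapping.keys Q. Poly_Mapping.single n (Poly_Mapping.lookup Q n))"
    by (simp add: sum_single_lookup)
  also have "\<dots> = (\<Sum>m\<in>Poly_Mapping.keys P. \<Sum>n\<in>Poly_Mapping.keys Q.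
      Poly_Mapping.single (m + n) (Poly_Mapping.lookup P m * Poly_Mapping.lookup Q n))"
    by (simp add: sum_product mult_single)
  finally have "rat_mpoly_eval x (P * Q) = (\<Sum>m\<in>Poly_Mapping.keys P. \<Sum>n\<in>Poly_Mapping.keys Q.
      (of_rat (Poly_Mapping.lookup P m) * mono_eval x m) * (of_rat (Poly_Mapping.lookup Q n) * mono_eval x n))"
    by (simp add: rat_mpoly_eval_sum rat_mpoly_eval_single mono_eval_add of_rat_mult mult_ac)
  then show ?thesis
    by (simp add: sum_product[symmetric] rat_mpoly_eval_def mono_eval_def)
qed

text \<open>Polynomials are handled through the functions they induce, so that later ones arise from
  closure rules rather than explicit coefficient maps.\<close>

definition rat_poly_fun :: "'i set \<Rightarrow> (('i \<Rightarrow> real) \<Rightarrow> real) \<Rightarrow> bool" where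
  "rat_poly_fun I f \<longleftrightarrow>
     (\<exists>P. (\<forall>m \<in> Poly_Mapping.keys P. Poly_Mapping.keys m \<subseteq> I) \<and> (\<forall>x. f x = rat_mpoly_eval x P))"

lemma rat_poly_fun_const:
  assumes "c \<in> \<rat>"
  shows "rat_poly_fun I (\<lambda>x. c)"
proof -
  obtain r where "c = of_rat r"
    using assms by (auto simp: Rats_def)
  then show ?thesis
    unfolding rat_poly_fun_def
    by (intro exI[of _ "Poly_Mapping.single 0 r"]) (auto simp: rat_mpoly_eval_single mono_eval_def)
qed

lemma rat_poly_fun_coord:
  assumes "i \<in> I"
  shows "rat_poly_fun I (\<lambda>x. x i)"
  unfolding rat_poly_fun_def
  using assms
  by (intro exI[of _ "Poly_Mapping.single (Poly_Mapping.single i 1) 1"])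
     (auto simp: rat_mpoly_eval_single mono_eval_def)

lemma rat_poly_fun_add:
  assumes "rat_poly_fun I f" "rat_poly_fun I g"
  shows "rat_poly_fun I (\<lambda>x. f x + g x)"
proof -
  obtain P Q where "\<forall>m \<in> Poly_Mapping.keys P. Poly_Mapping.keys m \<subseteq> I" "\<forall>x. f x = rat_mpoly_eval x P"
    "\<forall>m \<in> Poly_Mapping.keys Q. Poly_Mapping.keys m \<subseteq> I" "\<forall>x. g x = rat_mpoly_eval x Q"
    using assms unfolding rat_poly_fun_def by blast
  moreover have "Poly_Mapping.keys (P + Q) \<subseteq> Poly_Mapping.keys P \<union> Poly_Mapping.keys Q"
    by (rule keys_add)
  ultimately show ?thesis
    unfolding rat_poly_fun_def
    by (intro exI[of _ "P + Q"]) (simp add: rat_mpoly_eval_add, blast)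
qed

lemma rat_poly_fun_mult:
  assumes "rat_poly_fun I f" "rat_poly_fun I g"
  shows "rat_poly_fun I (\<lambda>x. f x * g x)"
proof -
  obtain P Q where PQ: "\<forall>m \<in> Poly_Mapping.keys P. Poly_Mapping.keys m \<subseteq> I" "\<forall>x. f x = rat_mpoly_eval x P"
    "\<forall>m \<in> Poly_Mapping.keys Q. Poly_Mapping.keys m \<subseteq> I" "\<forall>x. g x = rat_mpoly_eval x Q"
    using assms unfolding rat_poly_fun_def by blast
  have "Poly_Mapping.keys k \<subseteq> I" if "k \<in> Poly_Mapping.keys (P * Q)" for k
  proof -
    from that keys_mult[of P Q] obtain m n
      where "k = m + n" "m \<in> Poly_Mapping.keys P" "n \<in> Poly_Mapping.keys Q"
      by blast
    then show ?thesis
      using PQ keys_add[of m n] by blast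
  qed
  then show ?thesis
    unfolding rat_poly_fun_def using PQ
    by (intro exI[of _ "P * Q"]) (auto simp: rat_mpoly_eval_mult)
qed

lemma rat_poly_fun_diff:
  assumes "rat_poly_fun I f" "rat_poly_fun I g"
  shows "rat_poly_fun I (\<lambda>x. f x - g x)"
proof -
  have "rat_poly_fun I (\<lambda>x. f x + (- 1) * g x)"
    by (intro rat_poly_fun_add rat_poly_fun_mult assms rat_poly_fun_const) auto
  then show ?thesis
    by simp
qed

text \<open>This is how genericity enters: any point \<open>y\<close> with \<open>f y\<close>
  nonzero shows that the underlying polynomial is nonzero, so it cannot vanish at an algebraically
  independent \<open>x\<close>.\<close>

lemma alg_independent_nonzero:
  assumes "algebraically_independent_over_rat I x" "rat_poly_fun I f" "f y \<noteq> 0"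
  shows "f x \<noteq> 0"
  using assms unfolding algebraically_independent_over_rat_def rat_poly_fun_def
  by (metis rat_mpoly_eval_0)

lemma rat_poly_fun_tendsto:
  assumes "rat_poly_fun I f" "\<And>i. i \<in> I \<Longrightarrow> ((\<lambda>n. y n i) \<longlongrightarrow> x i) F"
  shows "((\<lambda>n. f (y n)) \<longlongrightarrow> f x) F"
proof -
  obtain P where P: "\<forall>m \<in> Poly_Mapping.keys P. Poly_Mapping.keys m \<subseteq> I" "\<And>x. f x = rat_mpoly_eval x P"
    using assms(1) unfolding rat_poly_fun_def by blast
  show ?thesis
    unfolding P(2) rat_mpoly_eval_def
    using P(1) by (intro tendsto_sum tendsto_mult tendsto_const tendsto_prod tendsto_power assms(2)) auto
qed

section \<open>Existence of algebraically independent points\<close>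

lemma countable_poly_mapping_keys_subset:
  assumes "countable A"
  shows "countable {f :: 'k \<Rightarrow>\<^sub>0 ('v :: {zero, countable}). Poly_Mapping.keys f \<subseteq> A}" (is "countable ?M")
proof -
  \<comment> \<open>A finitely supported map is determined by its support and its values
    there.\<close>
  let ?g = "\<lambda>f :: 'k \<Rightarrow>\<^sub>0 'v. (Poly_Mapping.keys f, restrict (Poly_Mapping.lookup f) (Poly_Mapping.keys f))"
  have "inj ?g"
  proof (rule injI)
    fix f h :: "'k \<Rightarrow>\<^sub>0 'v"
    assume eq: "?g f = ?g h"
    show "f = h"
    proof (rule poly_mapping_eqI)
      fix k
      show "Poly_Mapping.lookup f k = Poly_Mapping.lookup h k"
        using eq by (cases "k \<in> Poly_Mapping.keys f") (auto simp: in_keys_iff dest: fun_cong[of _ _ k])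
    qed
  qed
  moreover have "?g ` ?M \<subseteq> (SIGMA K : {K. K \<subseteq> A \<and> finite K}. K \<rightarrow>\<^sub>E UNIV)"
    by auto
  moreover have "countable (SIGMA K : {K. K \<subseteq> A \<and> finite K}. K \<rightarrow>\<^sub>E (UNIV :: 'v set))"
    using assms
    by (intro countable_SIGMA countable_PiE) (auto simp: countable_Collect_finite_subset conj_commute)
  ultimately show ?thesis
    by (meson countable_image_inj_on countable_subset inj_on_subset subset_UNIV)
qed

text \<open>With the other coordinates fixed, each nonzero polynomial in the variables
  \<open>insert i I\<close> becomes a nonzero polynomial in \<open>t\<close> and excludes finitely
  many values. There are only countably many such polynomials, so some real \<open>t\<close>
  survives.\<close>

lemma alg_independent_insert:
  fixes x :: "'i \<Rightarrow> real"
  assumes x: "algebraically_independent_over_rat I x" and "finite I" "i \<notin> I"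
  obtains t where "algebraically_independent_over_rat (insert i I) (x(i := t))"
proof -
  define \<P> where "\<P> = {P :: ('i \<Rightarrow>\<^sub>0 nat) \<Rightarrow>\<^sub>0 rat. P \<noteq> 0 \<and> (\<forall>m\<in>Poly_Mapping.keys P. Poly_Mapping.keys m \<subseteq> insert i I)}"
  define Z where "Z = (\<lambda>P. {t. rat_mpoly_eval (x(i := t)) P = 0})"
  have fin: "finite (Z P)" if P: "P \<in> \<P>" for P
  proof -
    let ?l = "\<lambda>m. Poly_Mapping.lookup m i"
    define del where "del = (\<lambda>m :: 'i \<Rightarrow>\<^sub>0 nat. Poly_Mapping.update i 0 m)"
    have lookup_del: "Poly_Mapping.lookup (del m) j = (if j = i then 0 else Poly_Mapping.lookup m j)" for m j
      by (simp add: del_def lookup_update)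
    have keys_del: "Poly_Mapping.keys (del m) = Poly_Mapping.keys m - {i}" for m
      by (auto simp: in_keys_iff lookup_del split: if_splits)
    have split: "mono_eval (x(i := t)) m = mono_eval x (del m) * t ^ ?l m" for m t
    proof -
      have "mono_eval (x(i := t)) m = (\<Prod>j\<in>insert i (Poly_Mapping.keys m - {i}). (x(i := t)) j ^ Poly_Mapping.lookup m j)"
        by (intro mono_eval_superset) auto
      also have "\<dots> = t ^ ?l m * (\<Prod>j\<in>Poly_Mapping.keys m - {i}. x j ^ Poly_Mapping.lookup m j)"
        by (subst prod.insert) auto
      finally show ?thesis
        by (simp add: mono_eval_def keys_del lookup_del mult.commute)
    qed
    obtain m0 where m0: "m0 \<in> Poly_Mapping.keys P"
      using P by (auto simp: \<P>_def simp flip: keys_eq_empty)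
    define coef where "coef = (\<lambda>n. \<Sum>m\<in>{m \<in> Poly_Mapping.keys P. ?l m = n}. of_rat (Poly_Mapping.lookup P m) * mono_eval x (del m))"
    define N where "N = Max (?l ` Poly_Mapping.keys P)"
    have N: "?l m \<le> N" if "m \<in> Poly_Mapping.keys P" for m
      unfolding N_def using that by (intro Max_ge) auto
    have poly: "rat_mpoly_eval (x(i := t)) P = (\<Sum>n\<le>N. coef n * t ^ n)" for t
    proof -
      have "rat_mpoly_eval (x(i := t)) P = (\<Sum>m\<in>Poly_Mapping.keys P. of_rat (Poly_Mapping.lookup P m) * mono_eval x (del m) * t ^ ?l m)"
        unfolding rat_mpoly_eval_def mono_eval_def[symmetric] by (simp only: split mult.assoc)
      also have "\<dots> = (\<Sum>n\<le>N. \<Sum>m\<in>{m \<in> Poly_Mapping.keys P. ?l m = n}. of_rat (Poly_Mapping.lookup P m) * mono_eval x (del m) * t ^ ?l m)"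
        using N by (intro sum.group[symmetric]) auto
      also have "\<dots> = (\<Sum>n\<le>N. coef n * t ^ n)"
        by (auto simp: coef_def sum_distrib_right intro!: sum.cong)
      finally show ?thesis .
    qed
    \<comment> \<open>\<open>Q\<close> is the coefficient of the power of \<open>t\<close> occurring
      in \<open>m0\<close>, as a polynomial in the variables \<open>I\<close>. Monomials with equal
      exponent of \<open>i\<close> stay distinct under \<open>del\<close>, so nothing cancels and
      \<open>Q\<close> is nonzero.\<close>
    define Q where "Q = (\<Sum>m\<in>{m \<in> Poly_Mapping.keys P. ?l m = ?l m0}. Poly_Mapping.single (del m) (Poly_Mapping.lookup P m))"
    have "del m = del m0 \<longleftrightarrow> m = m0" if "?l m = ?l m0" for m
      using that by (auto simp: poly_mapping_eq_iff fun_eq_iff lookup_del split: if_splits)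
    then have "Poly_Mapping.lookup Q (del m0) = (\<Sum>m\<in>{m \<in> Poly_Mapping.keys P. ?l m = ?l m0}. if m = m0 then Poly_Mapping.lookup P m else 0)"
      unfolding Q_def lookup_sum lookup_single when_def by (intro sum.cong) auto
    also have "\<dots> \<noteq> 0"
      using m0 by (simp add: in_keys_iff)
    finally have "Q \<noteq> 0"
      by auto
    moreover have "Poly_Mapping.keys m \<subseteq> I" if "m \<in> Poly_Mapping.keys Q" for m
    proof -
      have "m \<in> del ` Poly_Mapping.keys P"
        using that keys_sum[of "\<lambda>m. Poly_Mapping.single (del m) (Poly_Mapping.lookup P m)" "{m \<in> Poly_Mapping.keys P. ?l m = ?l m0}"]
        unfolding Q_def by (auto split: if_splits)
      then show ?thesis
        using P by (fastforce simp: keys_del \<P>_def)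
    qed
    ultimately have "rat_mpoly_eval x Q \<noteq> 0"
      using x unfolding algebraically_independent_over_rat_def by blast
    moreover have "rat_mpoly_eval x Q = coef (?l m0)"
      by (simp add: Q_def coef_def rat_mpoly_eval_sum rat_mpoly_eval_single)
    ultimately have "\<exists>n\<le>N. coef n \<noteq> 0"
      using N m0 by auto
    then have "finite {t. (\<Sum>n\<le>N. coef n * t ^ n) = 0}"
      by (simp add: polyfun_finite_roots)
    then show ?thesis
      by (simp add: Z_def poly)
  qed
  have "countable \<P>"
  proof (rule countable_subset)
    show "countable {P :: ('i \<Rightarrow>\<^sub>0 nat) \<Rightarrow>\<^sub>0 rat. Poly_Mapping.keys P \<subseteq> {m. Poly_Mapping.keys m \<subseteq> insert i I}}"
      using \<open>finite I\<close> by (intro countable_poly_mapping_keys_subset) (auto intro: countable_finite)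
  qed (auto simp: \<P>_def)
  then have "countable (\<Union>P\<in>\<P>. Z P)"
    using fin by (auto intro: countable_finite)
  then have "(\<Union>P\<in>\<P>. Z P) \<noteq> UNIV"
    using uncountable_UNIV_real by metis
  then obtain t where "t \<notin> (\<Union>P\<in>\<P>. Z P)"
    by blast
  then have "algebraically_independent_over_rat (insert i I) (x(i := t))"
    unfolding algebraically_independent_over_rat_def by (auto simp: Z_def \<P>_def)
  then show thesis
    by (rule that)
qed

lemma alg_independent_exists:
  assumes "finite I"
  shows "\<exists>x. algebraically_independent_over_rat I x"
  using assms
proof (induction I)
  case empty
  have "P = 0" if P: "\<forall>m\<in>Poly_Mapping.keys P. Poly_Mapping.keys m \<subseteq> {}" "rat_mpoly_eval x P = 0"
    for P :: "('a \<Rightarrow>\<^sub>0 nat) \<Rightarrow>\<^sub>0 rat" and x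
  proof -
    have "Poly_Mapping.keys P \<subseteq> {0}"
      using P(1) by auto
    then have "rat_mpoly_eval x P = of_rat (Poly_Mapping.lookup P 0)"
      by (subst rat_mpoly_eval_superset[of "{0}"]) (auto simp: mono_eval_def)
    then have "Poly_Mapping.lookup P 0 = 0"
      using P(2) by simp
    then have "0 \<notin> Poly_Mapping.keys P"
      by (simp add: in_keys_iff)
    then show ?thesis
      using \<open>Poly_Mapping.keys P \<subseteq> {0}\<close> by (auto simp flip: keys_eq_empty)
  qed
  then show ?case
    unfolding algebraically_independent_over_rat_def by blast
next
  case (insert i I)
  then show ?case
    using alg_independent_insert by metis
qed

section \<open>Linearly independent families of functions\<close>

text \<open>Independence is that of an indexed family, so equal functions at different indices are
  dependent. \<open>X\<close> is the set of columns, which shrinks under elimination.\<close>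

definition fam_indep :: "'x set \<Rightarrow> 'e set \<Rightarrow> ('e \<Rightarrow> 'x \<Rightarrow> real) \<Rightarrow> bool" where
  "fam_indep X F w \<longleftrightarrow> (\<forall>c. (\<forall>x\<in>X. (\<Sum>e\<in>F. c e * w e x) = 0) \<longrightarrow> (\<forall>e\<in>F. c e = 0))"

lemma fam_indepD:
  assumes "fam_indep X F w" "\<And>x. x \<in> X \<Longrightarrow> (\<Sum>e\<in>F. c e * w e x) = 0" "e \<in> F"
  shows "c e = 0"
  using assms unfolding fam_indep_def by blast

lemma fam_indep_empty [simp]: "fam_indep X {} w"
  by (simp add: fam_indep_def)

lemma fam_indep_cong:
  assumes "\<And>e x. e \<in> F \<Longrightarrow> x \<in> X \<Longrightarrow> w e x = w' e x"
  shows "fam_indep X F w \<longleftrightarrow> fam_indep X F w'"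
  using assms by (simp add: fam_indep_def)

text \<open>Pairing a vanishing combination with \<open>z\<close> leaves only the term of
  \<open>f\<close>. A motion can thus certify that an edge row lies outside the span of
  others.\<close>

lemma fam_indep_insert_dual:
  assumes "fam_indep X F w" "finite F" "f \<notin> F"
    and "\<And>e. e \<in> F \<Longrightarrow> (\<Sum>x\<in>X. w e x * z x) = 0" "(\<Sum>x\<in>X. w f x * z x) \<noteq> 0"
  shows "fam_indep X (insert f F) w"
  unfolding fam_indep_def
proof (intro allI impI)
  fix c assume c: "\<forall>x\<in>X. (\<Sum>e\<in>insert f F. c e * w e x) = 0"
  have "0 = (\<Sum>x\<in>X. (\<Sum>e\<in>insert f F. c e * w e x) * z x)"
    using c by simp
  also have "\<dots> = (\<Sum>e\<in>insert f F. c e * (\<Sum>x\<in>X. w e x * z x))"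
    unfolding sum_distrib_left sum_distrib_right by (subst sum.swap) (simp add: mult_ac)
  also have "\<dots> = c f * (\<Sum>x\<in>X. w f x * z x)"
    using assms by simp
  finally have cf: "c f = 0"
    using assms by simp
  then have "c e = 0" if "e \<in> F" for e
    using c assms that by (intro fam_indepD[OF assms(1), of c]) auto
  then show "\<forall>e\<in>insert f F. c e = 0"
    using cf by simp
qed

lemma fam_indep_insert_pivot:
  assumes "fam_indep X (insert f F) w" "f \<notin> F" "finite F"
  obtains x where "x \<in> X" "w f x \<noteq> 0"
proof -
  have "\<exists>x\<in>X. w f x \<noteq> 0"
  proof (rule ccontr)
    assume "\<not> (\<exists>x\<in>X. w f x \<noteq> 0)"
    then have "(if f = f then 1 else 0 :: real) = 0"
      by (intro fam_indepD[OF assms(1), of "\<lambda>e. if e = f then 1 else 0"]) (auto intro!: sum.neutral)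
    then show False by simp
  qed
  then show thesis
    using that by blast
qed

text \<open>One step of Gaussian elimination with pivot \<open>w f x\<close>, cleared of denominators.\<close>

lemma fam_indep_eliminate:
  assumes "x \<in> X" "w f x \<noteq> 0" "f \<notin> F" "finite F"
  defines "w' \<equiv> \<lambda>e y. w f x * w e y - w e x * w f y"
  shows "fam_indep X (insert f F) w \<longleftrightarrow> fam_indep (X - {x}) F w'"
proof
  assume L: "fam_indep X (insert f F) w"
  show "fam_indep (X - {x}) F w'"
    unfolding fam_indep_def
  proof (intro allI impI ballI)
    fix c e assume c: "\<forall>y\<in>X - {x}. (\<Sum>e\<in>F. c e * w' e y) = 0" and e: "e \<in> F"
    define c' where "c' = (\<lambda>e. if e = f then - (\<Sum>e\<in>F. c e * w e x) else c e * w f x)"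
    have "(\<Sum>e\<in>insert f F. c' e * w e y) = (\<Sum>e\<in>F. c e * w' e y)" for y
    proof -
      have "(\<Sum>e\<in>F. c' e * w e y) = (\<Sum>e\<in>F. c e * w f x * w e y)"
        using assms by (intro sum.cong) (auto simp: c'_def)
      then show ?thesis
        using assms
        by (simp add: c'_def w'_def sum_subtractf sum_distrib_left algebra_simps)
    qed
    moreover have "(\<Sum>e\<in>F. c e * w' e x) = 0"
      by (simp add: w'_def mult.commute)
    ultimately have "(\<Sum>e\<in>insert f F. c' e * w e y) = 0" if "y \<in> X" for y
      using c that by (cases "y = x") auto
    then have "c' e = 0"
      using e by (intro fam_indepD[OF L, of c']) auto
    then show "c e = 0"
      using assms(2,3) e by (auto simp: c'_def split: if_splits)
  qed
next
  assume R: "fam_indep (X - {x}) F w'"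
  show "fam_indep X (insert f F) w"
    unfolding fam_indep_def
  proof (intro allI impI)
    fix c assume c: "\<forall>x\<in>X. (\<Sum>e\<in>insert f F. c e * w e x) = 0"
    have eq: "c f * w f y + (\<Sum>e\<in>F. c e * w e y) = 0" if "y \<in> X" for y
      using c that assms by simp
    have "(\<Sum>e\<in>F. c e * w' e y) = 0" if "y \<in> X" for y
    proof -
      have "(\<Sum>e\<in>F. c e * w' e y) = w f x * (\<Sum>e\<in>F. c e * w e y) - w f y * (\<Sum>e\<in>F. c e * w e x)"
        by (simp add: w'_def sum_subtractf sum_distrib_left algebra_simps)
      also have "\<dots> = w f x * (- c f * w f y) - w f y * (- c f * w f x)"
        using eq[OF that] eq[OF assms(1)] by (simp add: add_eq_0_iff)
      finally show ?thesis by simp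
    qed
    then have 0: "c e = 0" if "e \<in> F" for e
      using that by (intro fam_indepD[OF R, of c]) auto
    then have "c f = 0"
      using eq[OF assms(1)] assms(2) by simp
    then show "\<forall>e\<in>insert f F. c e = 0"
      using 0 by simp
  qed
qed

text \<open>Each elimination step uses up one index and one column.\<close>

lemma fam_indep_card_le:
  assumes "finite F" "finite X" "fam_indep X F w"
  shows "card F \<le> card X"
  using assms
proof (induction F arbitrary: X w)
  case (insert f F)
  obtain x where x: "x \<in> X" "w f x \<noteq> 0"
    using fam_indep_insert_pivot[OF insert.prems(2) insert.hyps(2,1)] .
  have "card F \<le> card (X - {x})"
    using insert.IH insert.prems fam_indep_eliminate[where w = w and f = f, OF x insert.hyps(2,1)] by auto
  then show ?case
    using insert x by (simp add: card_gt_0_iff) (metis Suc_pred card_gt_0_iff empty_iff not_less_eq_eq)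
qed simp

text \<open>Converse of \<open>fam_indep_insert_dual\<close>: eliminating with a row of
  \<open>F\<close> removes a column, and a solution of the smaller system extends to that
  column.\<close>

lemma fam_indep_dual:
  assumes "finite F" "finite X" "e0 \<notin> F" "fam_indep X (insert e0 F) w"
  shows "\<exists>z. (\<forall>e\<in>F. (\<Sum>x\<in>X. w e x * z x) = 0) \<and> (\<Sum>x\<in>X. w e0 x * z x) \<noteq> 0"
  using assms
proof (induction F arbitrary: X w)
  case empty
  obtain x where x: "x \<in> X" "w e0 x \<noteq> 0"
    using fam_indep_insert_pivot[of X e0 "{}" w] empty by auto
  have "(\<Sum>y\<in>X. w e0 y * of_bool (y = x)) = w e0 x"
    using x empty by (simp add: sum.remove[of X x])
  then show ?case
    using x by (intro exI[of _ "\<lambda>y. of_bool (y = x)"]) auto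
next
  case (insert f F)
  have ins: "fam_indep X (insert f (insert e0 F)) w" "f \<notin> insert e0 F" "finite (insert e0 F)"
    using insert by (auto simp: insert_commute)
  obtain x where x: "x \<in> X" "w f x \<noteq> 0"
    using fam_indep_insert_pivot[OF ins] .
  define w' where "w' = (\<lambda>e y. w f x * w e y - w e x * w f y)"
  have "fam_indep (X - {x}) (insert e0 F) w'"
    using fam_indep_eliminate[where w = w and f = f, OF x ins(2,3)] ins(1) by (simp add: w'_def)
  then obtain z where z: "\<forall>e\<in>F. (\<Sum>y\<in>X - {x}. w' e y * z y) = 0" "(\<Sum>y\<in>X - {x}. w' e0 y * z y) \<noteq> 0"
    using insert.IH[of "X - {x}" w'] insert.prems by auto
  \<comment> \<open>The value at the pivot column is the one that makes the row \<open>f\<close>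
    orthogonal to \<open>z'\<close>.\<close>
  define z' where "z' = z(x := - (\<Sum>y\<in>X - {x}. w f y * z y) / w f x)"
  have sum: "(\<Sum>y\<in>X. w e y * z' y) = (\<Sum>y\<in>X - {x}. w' e y * z y) / w f x" for e
  proof -
    have "(\<Sum>y\<in>X. w e y * z' y) = w e x * z' x + (\<Sum>y\<in>X - {x}. w e y * z' y)"
      using x insert.prems by (simp add: sum.remove)
    also have "(\<Sum>y\<in>X - {x}. w e y * z' y) = (\<Sum>y\<in>X - {x}. w e y * z y)"
      by (intro sum.cong) (auto simp: z'_def)
    also have "w e x * z' x + \<dots> = (\<Sum>y\<in>X - {x}. w' e y * z y) / w f x"
      using x by (simp add: z'_def w'_def left_diff_distrib sum_subtractf field_simps sum_distrib_left)
    finally show ?thesis .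
  qed
  have "w' f y = 0" for y
    by (simp add: w'_def)
  then have "(\<forall>e\<in>insert f F. (\<Sum>y\<in>X. w e y * z' y) = 0) \<and> (\<Sum>y\<in>X. w e0 y * z' y) \<noteq> 0"
    using z x by (auto simp: sum)
  then show ?case by blast
qed

text \<open>Elimination cleared of denominators keeps the entries polynomial. The product
  \<open>D\<close> of the pivots chosen at \<open>q\<close> then certifies independence wherever it
  does not vanish.\<close>

lemma fam_indep_generic:
  assumes "finite F" "\<And>e x. e \<in> F \<Longrightarrow> x \<in> X \<Longrightarrow> rat_poly_fun I (\<lambda>q. w q e x)" "fam_indep X F (w q)"
  shows "\<exists>D. rat_poly_fun I D \<and> D q \<noteq> 0 \<and> (\<forall>p. D p \<noteq> 0 \<longrightarrow> fam_indep X F (w p))"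
  using assms
proof (induction F arbitrary: X w)
  case empty
  then show ?case
    by (intro exI[of _ "\<lambda>_. 1"]) (auto intro: rat_poly_fun_const)
next
  case (insert f F)
  obtain x where x: "x \<in> X" "w q f x \<noteq> 0"
    using fam_indep_insert_pivot[OF insert.prems(2) insert.hyps(2,1)] .
  define w' where "w' = (\<lambda>p e y. w p f x * w p e y - w p e x * w p f y)"
  have elim: "fam_indep X (insert f F) (w p) \<longleftrightarrow> fam_indep (X - {x}) F (w' p)" if "w p f x \<noteq> 0" for p
    using fam_indep_eliminate[of x X "w p" f F] that x insert.hyps by (simp add: w'_def)
  have "rat_poly_fun I (\<lambda>p. w' p e y)" if "e \<in> F" "y \<in> X - {x}" for e y
    unfolding w'_def using that x by (intro rat_poly_fun_diff rat_poly_fun_mult insert.prems) auto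
  then obtain D where D: "rat_poly_fun I D" "D q \<noteq> 0" "\<And>p. D p \<noteq> 0 \<Longrightarrow> fam_indep (X - {x}) F (w' p)"
    using insert.IH[of "X - {x}" w'] elim x insert.prems by blast
  have "rat_poly_fun I (\<lambda>p. D p * w p f x)"
    using x by (intro rat_poly_fun_mult D insert.prems) auto
  then show ?case
    using D x elim by (intro exI[of _ "\<lambda>p. D p * w p f x"]) auto
qed

lemma fam_indep_transfer:
  assumes "algebraically_independent_over_rat I p" "finite F"
    and "\<And>e x. e \<in> F \<Longrightarrow> x \<in> X \<Longrightarrow> rat_poly_fun I (\<lambda>q. w q e x)" "fam_indep X F (w q)"
  shows "fam_indep X F (w p)"
  using fam_indep_generic[OF assms(2-4)] alg_independent_nonzero[OF assms(1)] by blast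

section \<open>Averaging over vertex orderings\<close>

text \<open>
  The probability that, in a uniformly random ordering of \<open>a + b + 1\<close> elements, a given element is
  preceded by exactly the elements of a given set of size \<open>a\<close>.
\<close>

definition order_weight :: "nat \<Rightarrow> nat \<Rightarrow> real" where
  "order_weight a b = fact a * fact b / fact (a + b + 1)"

lemma order_weight_nonneg: "order_weight a b \<ge> 0"
  by (simp add: order_weight_def)

text \<open>Conditioning on whether one further element comes before or after the given one.\<close>

lemma order_weight_split: "order_weight (Suc a) b + order_weight a (Suc b) = order_weight a b"
proof -
  have "(fact (Suc a) * fact b + fact a * fact (Suc b) :: real) = fact a * fact b * (real a + real b + 2)"
    by (simp add: algebra_simps)
  moreover have "(fact (a + b + 2) :: real) = fact (a + b + 1) * (real a + real b + 2)"
    by (simp add: algebra_simps)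
  ultimately show ?thesis
    unfolding order_weight_def by (simp add: add_divide_distrib[symmetric] del: fact_Suc)
qed

text \<open>\<open>T\<close> collects the elements of \<open>M\<close> that precede the given one;
  summing over all \<open>T\<close> forgets the positions of \<open>M\<close>.\<close>

lemma order_weight_sum_Pow:
  assumes "finite M"
  shows "(\<Sum>T\<in>Pow M. order_weight (a + card T) (b + (card M - card T))) = order_weight a b"
  using assms
proof (induction M arbitrary: a b)
  case (insert x M)
  have "(\<Sum>T\<in>Pow (insert x M). order_weight (a + card T) (b + (card (insert x M) - card T)))
    = (\<Sum>T\<in>Pow M. order_weight (a + card T) (b + (card (insert x M) - card T)))
      + (\<Sum>T\<in>insert x ` Pow M. order_weight (a + card T) (b + (card (insert x M) - card T)))"
    unfolding Pow_insert using insert by (intro sum.union_disjoint) auto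
  also have "(\<Sum>T\<in>Pow M. order_weight (a + card T) (b + (card (insert x M) - card T)))
    = (\<Sum>T\<in>Pow M. order_weight (a + card T) (Suc b + (card M - card T)))"
    using insert by (intro sum.cong) (auto simp: Suc_diff_le card_mono)
  also have "\<dots> = order_weight a (Suc b)"
    by (rule insert.IH)
  also have "(\<Sum>T\<in>insert x ` Pow M. order_weight (a + card T) (b + (card (insert x M) - card T)))
    = (\<Sum>T\<in>Pow M. order_weight (a + card (insert x T)) (b + (card (insert x M) - card (insert x T))))"
  proof (rule sum.reindex_cong[of "insert x"])
    show "inj_on (insert x) (Pow M)"
      using insert.hyps by (auto simp: inj_on_def)
  qed auto
  also have "\<dots> = (\<Sum>T\<in>Pow M. order_weight (Suc a + card T) (b + (card M - card T)))"
  proof (intro sum.cong refl)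
    fix T assume "T \<in> Pow M"
    then have "finite T" "x \<notin> T"
      using insert finite_subset by auto
    then show "order_weight (a + card (insert x T)) (b + (card (insert x M) - card (insert x T))) =
      order_weight (Suc a + card T) (b + (card M - card T))"
      using insert by simp
  qed
  also have "\<dots> = order_weight (Suc a) b"
    by (rule insert.IH)
  finally show ?case
    using order_weight_split[of a b] by simp
qed simp

text \<open>Along every ordering the increments of \<open>r\<close> add up to
  \<open>r W - r {}\<close>, hence so do their expectations. The proof collects the coefficient of
  each \<open>r T\<close> instead.\<close>

lemma order_weight_telescope:
  fixes r :: "'v set \<Rightarrow> real"
  assumes "finite W"
  shows "(\<Sum>v\<in>W. \<Sum>S\<in>Pow (W - {v}). order_weight (card S) (card W - 1 - card S) * (r (insert v S) - r S))
    = r W - r {}"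
proof -
  define n where "n = card W"
  \<comment> \<open>\<open>\<phi> t\<close> is the probability that a given \<open>t\<close>-set is
    an initial segment. Insertions ending at \<open>T\<close> and those starting from
    \<open>T\<close> contribute it with opposite signs, so only \<open>{}\<close> and
    \<open>W\<close> remain.\<close>
  define \<phi> where "\<phi> = (\<lambda>t. fact t * fact (n - t) / (fact n :: real))"
  let ?A = "SIGMA v:W. Pow (W - {v})"
  have finA: "finite ?A"
    using assms by auto
  have up: "(\<Sum>(v,S)\<in>?A. order_weight (card S) (n - 1 - card S) * r (insert v S))
    = (\<Sum>T\<in>Pow W - {{}}. \<phi> (card T) * r T)"
  proof -
    have "(\<Sum>(v,S)\<in>?A. order_weight (card S) (n - 1 - card S) * r (insert v S))
      = (\<Sum>(T,v)\<in>(SIGMA T:Pow W. T). order_weight (card T - 1) (n - card T) * r T)"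
    proof (rule sum.reindex_bij_witness[of _ "\<lambda>(T,v). (v, T - {v})" "\<lambda>(v,S). (insert v S, v)"])
      fix a assume "a \<in> ?A"
      then obtain v S where a: "a = (v,S)" "v \<in> W" "S \<subseteq> W - {v}"
        by auto
      then have "finite S" "v \<notin> S"
        using assms finite_subset by auto
      then show "(case case a of (v,S) \<Rightarrow> (insert v S, v) of (T,v) \<Rightarrow> order_weight (card T - 1) (n - card T) * r T)
        = (case a of (v,S) \<Rightarrow> order_weight (card S) (n - 1 - card S) * r (insert v S))"
        using a by simp
    qed auto
    also have "\<dots> = (\<Sum>T\<in>Pow W. \<Sum>v\<in>T. order_weight (card T - 1) (n - card T) * r T)"
      using assms by (intro sum.Sigma[symmetric]) (auto intro: finite_subset)
    also have "\<dots> = (\<Sum>T\<in>Pow W. card T * order_weight (card T - 1) (n - card T) * r T)"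
      by (simp add: mult.assoc)
    also have "\<dots> = (\<Sum>T\<in>Pow W - {{}}. card T * order_weight (card T - 1) (n - card T) * r T)"
      using assms by (intro sum.mono_neutral_right) auto
    also have "\<dots> = (\<Sum>T\<in>Pow W - {{}}. \<phi> (card T) * r T)"
    proof (intro sum.cong refl)
      fix T assume "T \<in> Pow W - {{}}"
      then have T: "card T > 0" "card T \<le> n"
        using assms by (auto simp: card_gt_0_iff n_def card_mono intro: finite_subset)
      then have "(card T - 1) + (n - card T) + 1 = n"
        by simp
      moreover have "real (card T) * fact (card T - 1) = fact (card T)"
        using T fact_reduce[of "card T", where 'a = real] by simp
      ultimately show "card T * order_weight (card T - 1) (n - card T) * r T = \<phi> (card T) * r T"
        unfolding order_weight_def \<phi>_def by (simp only: times_divide_eq_right mult.assoc[symmetric])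
    qed
    finally show ?thesis .
  qed
  have down: "(\<Sum>(v,S)\<in>?A. order_weight (card S) (n - 1 - card S) * r S)
    = (\<Sum>T\<in>Pow W - {W}. \<phi> (card T) * r T)"
  proof -
    have "(\<Sum>(v,S)\<in>?A. order_weight (card S) (n - 1 - card S) * r S)
      = (\<Sum>(T,v)\<in>(SIGMA T:Pow W. W - T). order_weight (card T) (n - 1 - card T) * r T)"
      by (rule sum.reindex_bij_witness[of _ "\<lambda>(T,v). (v, T)" "\<lambda>(v,S). (S, v)"]) auto
    also have "\<dots> = (\<Sum>T\<in>Pow W. \<Sum>v\<in>W - T. order_weight (card T) (n - 1 - card T) * r T)"
      using assms by (intro sum.Sigma[symmetric]) (auto intro: finite_subset)
    also have "\<dots> = (\<Sum>T\<in>Pow W. card (W - T) * order_weight (card T) (n - 1 - card T) * r T)"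
      by (simp add: mult.assoc)
    also have "\<dots> = (\<Sum>T\<in>Pow W - {W}. card (W - T) * order_weight (card T) (n - 1 - card T) * r T)"
      using assms by (intro sum.mono_neutral_right) auto
    also have "\<dots> = (\<Sum>T\<in>Pow W - {W}. \<phi> (card T) * r T)"
    proof (intro sum.cong refl)
      fix T assume "T \<in> Pow W - {W}"
      then have T: "T \<subset> W" "finite T"
        using assms by (auto intro: finite_subset)
      then have less: "card T < n"
        using assms psubset_card_mono unfolding n_def by blast
      have c: "card (W - T) = n - card T"
        using T assms by (simp add: card_Diff_subset n_def psubset_imp_subset)
      have "card T + (n - 1 - card T) + 1 = n"
        using less by simp
      moreover have "real (n - card T) * fact (n - 1 - card T) = fact (n - card T)"
        using less fact_reduce[of "n - card T", where 'a = real] by simp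
      ultimately show "card (W - T) * order_weight (card T) (n - 1 - card T) * r T = \<phi> (card T) * r T"
        unfolding order_weight_def \<phi>_def c by (metis (no_types, opaque_lifting) mult.left_commute times_divide_eq_right)
    qed
    finally show ?thesis .
  qed
  have "(\<Sum>v\<in>W. \<Sum>S\<in>Pow (W - {v}). order_weight (card S) (card W - 1 - card S) * (r (insert v S) - r S))
    = (\<Sum>(v,S)\<in>?A. order_weight (card S) (n - 1 - card S) * (r (insert v S) - r S))"
    unfolding n_def using assms by (intro sum.Sigma) auto
  also have "\<dots> = (\<Sum>(v,S)\<in>?A. order_weight (card S) (n - 1 - card S) * r (insert v S))
      - (\<Sum>(v,S)\<in>?A. order_weight (card S) (n - 1 - card S) * r S)"
    by (simp add: sum_subtractf[symmetric] right_diff_distrib case_prod_beta)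
  also have "\<dots> = (\<Sum>T\<in>Pow W - {{}}. \<phi> (card T) * r T) - (\<Sum>T\<in>Pow W - {W}. \<phi> (card T) * r T)"
    by (simp only: up down)
  also have "\<dots> = \<phi> n * r W - \<phi> 0 * r {}"
    using assms sum.remove[of "Pow W" "{}" "\<lambda>T. \<phi> (card T) * r T"] sum.remove[of "Pow W" W "\<lambda>T. \<phi> (card T) * r T"]
    by (simp add: n_def)
  also have "\<dots> = r W - r {}"
    by (simp add: \<phi>_def)
  finally show ?thesis .
qed

text \<open>Double counting of pairs \<open>(B, b)\<close> with \<open>Q B\<close> and
  \<open>Q (B - {b})\<close>: by \<open>two\<close>, at most one element of \<open>B\<close> fails,
  and each \<open>s\<close>-set arises from at most \<open>k - s\<close> larger sets. Descending
  from \<open>N\<close>, at least a fraction \<open>i / k\<close> of the \<open>i\<close>-subsets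
  satisfies \<open>Q\<close>.\<close>

lemma hereditary_count:
  assumes "finite N" "card N = k" "Q N"
    and two: "\<And>B b c. B \<subseteq> N \<Longrightarrow> Q B \<Longrightarrow> card B \<ge> d + 2 \<Longrightarrow> b \<in> B \<Longrightarrow> c \<in> B \<Longrightarrow> b \<noteq> c \<Longrightarrow>
               Q (B - {b}) \<or> Q (B - {c})"
    and "d + 1 \<le> i" "i \<le> k"
  shows "(k - 1) choose (i - 1) \<le> card {B. B \<subseteq> N \<and> card B = i \<and> Q B}"
proof -
  define \<Q> where "\<Q> = (\<lambda>i. {B. B \<subseteq> N \<and> card B = i \<and> Q B})"
  have fin: "finite (\<Q> i)" for i
    unfolding \<Q>_def using assms(1) by auto
  have finB: "finite B" if "B \<in> \<Q> i" for B i
    using that assms(1) finite_subset unfolding \<Q>_def by auto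
  have step: "s * card (\<Q> (Suc s)) \<le> (k - s) * card (\<Q> s)" if s: "d + 1 \<le> s" for s
  proof -
    let ?P = "SIGMA B : \<Q> (Suc s). {b \<in> B. Q (B - {b})}"
    have "s \<le> card {b \<in> B. Q (B - {b})}" if B: "B \<in> \<Q> (Suc s)" for B
    proof -
      have B': "B \<subseteq> N" "card B = Suc s" "Q B"
        using B by (auto simp: \<Q>_def)
      have "card {b \<in> B. \<not> Q (B - {b})} \<le> 1"
        using two[of B] B' s finB[OF B] by (subst card_le_Suc0_iff_eq[unfolded One_nat_def[symmetric]]) auto
      moreover have "card B = card {b \<in> B. Q (B - {b})} + card {b \<in> B. \<not> Q (B - {b})}"
        using finB[OF B] by (subst card_Un_disjoint[symmetric]) (auto intro!: arg_cong[of _ _ card])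
      ultimately show ?thesis
        using B' by linarith
    qed
    then have "s * card (\<Q> (Suc s)) \<le> (\<Sum>B\<in>\<Q> (Suc s). card {b \<in> B. Q (B - {b})})"
      using sum_mono[of "\<Q> (Suc s)" "\<lambda>_. s"] by (simp add: mult.commute)
    also have "\<dots> = card ?P"
      using fin finB by (intro card_SigmaI[symmetric]) auto
    also have "\<dots> \<le> card (SIGMA C : \<Q> s. N - C)"
    proof (rule card_inj_on_le[of "\<lambda>(B,b). (B - {b}, b)"])
      show "inj_on (\<lambda>(B,b). (B - {b}, b)) ?P"
        by (auto simp: inj_on_def)
      show "(\<lambda>(B,b). (B - {b}, b)) ` ?P \<subseteq> (SIGMA C : \<Q> s. N - C)"
        using finB by (auto simp: \<Q>_def)
      show "finite (SIGMA C : \<Q> s. N - C)"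
        using fin assms(1) by auto
    qed
    also have "\<dots> = (\<Sum>C\<in>\<Q> s. card (N - C))"
      using fin assms(1) by (intro card_SigmaI) auto
    also have "\<dots> = (\<Sum>C\<in>\<Q> s. k - s)"
      using finB assms(1,2) by (intro sum.cong) (auto simp: \<Q>_def card_Diff_subset)
    finally show ?thesis
      by (simp add: mult.commute)
  qed
  have "d + 1 \<le> i \<longrightarrow> (k - 1) choose (i - 1) \<le> card (\<Q> i)"
    using \<open>i \<le> k\<close>
  proof (induction rule: inc_induct)
    case base
    have "N \<in> \<Q> k"
      using assms by (simp add: \<Q>_def)
    then have "card (\<Q> k) > 0"
      using fin card_gt_0_iff by blast
    then show ?case
      by simp
  next
    case (step s)
    show ?case
    proof
      assume s: "d + 1 \<le> s"
      \<comment> \<open>The binomial bounds satisfy the double-counting inequality with equality, so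
        they propagate from \<open>Suc s\<close> to \<open>s\<close>.\<close>
      have "(k - s) * ((k - 1) choose (s - 1)) = s * ((k - 1) choose s)"
        using binomial_absorb_comp[of "k - 1" "s - 1"] binomial_absorption[of "s - 1" "k - 1"] s step.hyps
        by simp
      also have "\<dots> \<le> s * card (\<Q> (Suc s))"
        using step s by simp
      also have "\<dots> \<le> (k - s) * card (\<Q> s)"
        using s by (rule \<open>\<And>s. d + 1 \<le> s \<Longrightarrow> s * card (\<Q> (Suc s)) \<le> (k - s) * card (\<Q> s)\<close>)
      finally show "(k - 1) choose (s - 1) \<le> card (\<Q> s)"
        using step.hyps by simp
    qed
  qed
  then show ?thesis
    using assms by (simp add: \<Q>_def)
qed

section \<open>Expected rank gain at a single vertex\<close>

lemma sum_min_atMost: "(\<Sum>i\<le>d + j. real (min d i)) = real d * (real d + real j + 1) - real d * (real d + 1) / 2"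
proof (induction j)
  case 0
  have "(\<Sum>i\<le>d. real (min d i)) = (\<Sum>i\<le>d. real i)"
    by (intro sum.cong) auto
  also have "\<dots> = real d * (real d + 1) / 2"
    by (induction d) (auto simp: field_simps)
  finally show ?case
    by (simp add: field_simps)
qed (simp add: algebra_simps)

lemma sum_greater_atMost:
  "(\<Sum>i\<le>d + j. if i \<ge> d + 1 then real i else 0) = ((real d + real j) * (real d + real j + 1) - real d * (real d + 1)) / 2"
proof (induction j)
  case 0
  have "(\<Sum>i\<le>d. if i \<ge> d + 1 then real i else 0) = 0"
    by (intro sum.neutral) auto
  then show ?case
    by simp
qed (simp add: field_simps)

text \<open>The number of predecessors among \<open>k\<close> other elements is uniform on
  \<open>0..k\<close>.\<close>

lemma choose_mult_order_weight:
  assumes "i \<le> k"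
  shows "real (k choose i) * order_weight i (k - i) = 1 / (real k + 1)"
proof -
  have "fact k + fact k * real k \<noteq> 0"
    using fact_gt_zero[of k, where 'a = real] by (smt (verit) mult_nonneg_nonneg of_nat_0_le_iff)
  then show ?thesis
    using assms by (simp add: order_weight_def binomial_fact field_simps)
qed

text \<open>Let \<open>i\<close> be the number of preceding elements of \<open>N\<close>, uniform on
  \<open>0..k\<close>. The mean of \<open>min d i\<close> falls short of \<open>d\<close> by
  \<open>d(d+1)/2\<close> divided by \<open>k+1\<close>. The extra unit, earned with probability at
  least \<open>i / k\<close> for \<open>i > d\<close>, contributes at least
  \<open>(k(k+1) - d(d+1)) / (2k)\<close> divided by \<open>k+1\<close>. This bound covers the
  shortfall exactly when \<open>d(d+1) \<le> k\<close>.\<close>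

lemma order_weight_sum_ge:
  fixes g :: "'v set \<Rightarrow> real"
  assumes "finite N" "card N = k" "Q N" "d * (d + 1) \<le> k" "d \<ge> 1"
    and two: "\<And>B b c. B \<subseteq> N \<Longrightarrow> Q B \<Longrightarrow> card B \<ge> d + 2 \<Longrightarrow> b \<in> B \<Longrightarrow> c \<in> B \<Longrightarrow> b \<noteq> c \<Longrightarrow>
               Q (B - {b}) \<or> Q (B - {c})"
    and g1: "\<And>B. B \<subseteq> N \<Longrightarrow> g B \<ge> min d (card B)"
    and g2: "\<And>B. B \<subseteq> N \<Longrightarrow> Q B \<Longrightarrow> card B \<ge> d + 1 \<Longrightarrow> g B \<ge> d + 1"
  shows "(\<Sum>B\<in>Pow N. order_weight (card B) (k - card B) * g B) \<ge> d"
proof -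
  define q where "q = (\<lambda>B. card B \<ge> d + 1 \<and> Q B)"
  have dk: "d \<le> k" "k > 0"
    using assms(4,5) by (auto intro: order_trans[of _ "d * (d + 1)"] simp: Suc_le_eq)
  have le: "order_weight (card B) (k - card B) * (real (min d (card B)) + of_bool (q B))
    \<le> order_weight (card B) (k - card B) * g B" if "B \<subseteq> N" for B
    using g1[OF that] g2[OF that] by (intro mult_left_mono order_weight_nonneg) (auto simp: q_def)
  have level: "(real (min d i) + (if i \<ge> d + 1 then real i / k else 0)) / (real k + 1) \<le>
     (\<Sum>B\<in>{B \<in> Pow N. card B = i}. order_weight (card B) (k - card B) * (real (min d (card B)) + of_bool (q B)))"
    if "i \<le> k" for i
  proof -
    define L where "L = {B \<in> Pow N. card B = i}"
    have finL: "finite L"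
      using assms(1) by (auto simp: L_def)
    have cardL: "card L = k choose i"
      using n_subsets[OF assms(1), of i] assms(2) by (simp add: L_def)
    have sumq: "(\<Sum>B\<in>L. of_bool (q B) :: real) = card {B \<in> L. q B}"
      using finL by (simp add: sum.If_cases of_bool_def Int_def)
    have "(\<Sum>B\<in>L. order_weight (card B) (k - card B) * (real (min d (card B)) + of_bool (q B)))
      = (\<Sum>B\<in>L. order_weight i (k - i) * (real (min d i) + of_bool (q B)))"
      by (intro sum.cong) (auto simp: L_def)
    also have "\<dots> = order_weight i (k - i) * (real (k choose i) * real (min d i) + card {B \<in> L. q B})"
      by (simp add: sum_distrib_left[symmetric] sum.distrib sumq cardL)
    also have "\<dots> = real (min d i) / (real k + 1) + order_weight i (k - i) * card {B \<in> L. q B}"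
      using arg_cong[OF choose_mult_order_weight[OF that], of "\<lambda>t. t * real (min d i)"]
      by (simp add: distrib_left mult_ac)
    finally have eq: "(\<Sum>B\<in>L. order_weight (card B) (k - card B) * (real (min d (card B)) + of_bool (q B)))
      = real (min d i) / (real k + 1) + order_weight i (k - i) * card {B \<in> L. q B}" .
    have "(if i \<ge> d + 1 then real i / k else 0) / (real k + 1) \<le> order_weight i (k - i) * card {B \<in> L. q B}"
    proof (cases "i \<ge> d + 1")
      case True
      have "{B \<in> L. q B} = {B. B \<subseteq> N \<and> card B = i \<and> Q B}"
        using True by (auto simp: q_def L_def)
      then have "real ((k - 1) choose (i - 1)) \<le> card {B \<in> L. q B}"
        using hereditary_count[of N k Q d i] assms that True by auto
      then have "order_weight i (k - i) * real ((k - 1) choose (i - 1)) \<le> order_weight i (k - i) * card {B \<in> L. q B}"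
        by (intro mult_left_mono order_weight_nonneg)
      moreover have "real k * real ((k - 1) choose (i - 1)) = real i * real (k choose i)"
        using True times_binomial_minus1_eq[of i k] by (simp flip: of_nat_mult)
      then have "real ((k - 1) choose (i - 1)) = real i / k * real (k choose i)"
        using dk by (simp add: field_simps)
      then have "order_weight i (k - i) * real ((k - 1) choose (i - 1)) = real i / k * (real (k choose i) * order_weight i (k - i))"
        by simp
      ultimately show ?thesis
        using True choose_mult_order_weight[OF that] by simp
    qed (simp add: order_weight_nonneg)
    then show ?thesis
      unfolding L_def[symmetric] eq by (simp add: add_divide_distrib)
  qed
  define j where "j = k - d"
  have kj: "k = d + j"
    using dk by (simp add: j_def)
  have "real d \<le> (\<Sum>i\<le>k. (real (min d i) + (if i \<ge> d + 1 then real i / k else 0)) / (real k + 1))"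
  proof -
    have "(\<Sum>i\<le>k. (real (min d i) + (if i \<ge> d + 1 then real i / k else 0)) / (real k + 1))
       = ((\<Sum>i\<le>k. real (min d i)) + (\<Sum>i\<le>k. if i \<ge> d + 1 then real i else 0) / k) / (real k + 1)"
      unfolding sum_divide_distrib[symmetric] sum.distrib
      by (simp add: sum_divide_distrib if_distrib[of "\<lambda>x. x / real k"] cong: if_cong)
    also have "(\<Sum>i\<le>k. real (min d i)) = real d * (real k + 1) - real d * (real d + 1) / 2"
      unfolding kj sum_min_atMost by simp
    also have "(\<Sum>i\<le>k. if i \<ge> d + 1 then real i else 0) = (real k * (real k + 1) - real d * (real d + 1)) / 2"
      unfolding kj sum_greater_atMost by simp
    finally have *: "(\<Sum>i\<le>k. (real (min d i) + (if i \<ge> d + 1 then real i / k else 0)) / (real k + 1)) =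
       (real d * (real k + 1) - real d * (real d + 1) / 2 + (real k * (real k + 1) - real d * (real d + 1)) / 2 / k) / (real k + 1)" .
    have dd: "real d * (real d + 1) \<le> k"
      using assms(4) by (metis of_nat_1 of_nat_add of_nat_le_iff of_nat_mult)
    have "(real k * (real k + 1) - real d * (real d + 1)) / 2 / k \<ge> real d * (real d + 1) / 2"
    proof -
      have "real k * (real d * (real d + 1)) + real d * (real d + 1) \<le> real k * (real k + 1)"
        using mult_left_mono[OF dd, of "real k + 1"] by (simp add: algebra_simps)
      then show ?thesis
        using dk by (simp add: field_simps)
    qed
    then show ?thesis
      unfolding * by (simp add: pos_le_divide_eq)
  qed
  also have "\<dots> \<le> (\<Sum>i\<le>k. \<Sum>B\<in>{B \<in> Pow N. card B = i}. order_weight (card B) (k - card B) * (real (min d (card B)) + of_bool (q B)))"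
    by (intro sum_mono level) auto
  also have "\<dots> = (\<Sum>B\<in>Pow N. order_weight (card B) (k - card B) * (real (min d (card B)) + of_bool (q B)))"
    using assms(1,2) by (intro sum.group) (auto intro: card_mono)
  also have "\<dots> \<le> (\<Sum>B\<in>Pow N. order_weight (card B) (k - card B) * g B)"
    by (intro sum_mono le) auto
  finally show ?thesis .
qed

text \<open>Elements outside \<open>N\<close> do not affect \<open>S \<inter> N\<close>; summing
  over their positions leaves a random ordering of \<open>N\<close> and the given element.\<close>

lemma order_weight_marginal:
  fixes g :: "'v set \<Rightarrow> real"
  assumes "finite U" "N \<subseteq> U"
  shows "(\<Sum>S\<in>Pow U. order_weight (card S) (card U - card S) * g (S \<inter> N))
    = (\<Sum>B\<in>Pow N. order_weight (card B) (card N - card B) * g B)"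
proof -
  let ?M = "U - N"
  have finN: "finite N"
    using assms finite_subset by auto
  have "(\<Sum>S\<in>Pow U. order_weight (card S) (card U - card S) * g (S \<inter> N))
    = (\<Sum>(B,T)\<in>Pow N \<times> Pow ?M. order_weight (card B + card T) ((card N - card B) + (card ?M - card T)) * g B)"
  proof (rule sum.reindex_bij_witness[of _ "\<lambda>(B,T). B \<union> T" "\<lambda>S. (S \<inter> N, S - N)"])
    fix S assume "S \<in> Pow U"
    then have S: "finite S" "S \<subseteq> U"
      using assms finite_subset by auto
    have 1: "card S = card (S \<inter> N) + card (S - N)"
      using S by (metis card_Int_Diff)
    have 2: "card U = card N + card ?M"
      using assms by (metis card_Int_Diff inf.absorb_iff2)
    have 3: "card (S \<inter> N) \<le> card N" "card (S - N) \<le> card ?M"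
      using S assms finN by (auto intro!: card_mono)
    have "card U - card S = (card N - card (S \<inter> N)) + (card ?M - card (S - N))"
      using 1 2 3 by linarith
    then show "(case (S \<inter> N, S - N) of (B,T) \<Rightarrow> order_weight (card B + card T) ((card N - card B) + (card ?M - card T)) * g B)
      = order_weight (card S) (card U - card S) * g (S \<inter> N)"
      using 1 by simp
  qed (use assms in auto)
  also have "\<dots> = (\<Sum>B\<in>Pow N. \<Sum>T\<in>Pow ?M. order_weight (card B + card T) ((card N - card B) + (card ?M - card T)) * g B)"
    by (simp add: sum.cartesian_product)
  also have "\<dots> = (\<Sum>B\<in>Pow N. order_weight (card B) (card N - card B) * g B)"
    using assms by (simp add: sum_distrib_right[symmetric] order_weight_sum_Pow)
  finally show ?thesis .
qed

section \<open>Rows of the rigidity matrix\<close>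

definition coords :: "('a \<Rightarrow> real ^ 'd) \<Rightarrow> 'a \<times> 'd \<Rightarrow> real" where
  "coords p = (\<lambda>(v, i). p v $ i)"

text \<open>The placement enters as a coordinate function, so that the entries are polynomial
  functions of it. The rows of \<open>(u, v)\<close> and \<open>(v, u)\<close> coincide.\<close>

definition rig_row :: "('a \<times> 'd \<Rightarrow> real) \<Rightarrow> 'a \<times> 'a \<Rightarrow> 'a \<times> 'd \<Rightarrow> real" where
  "rig_row x e y = (x (fst e, snd y) - x (snd e, snd y)) * (of_bool (fst y = fst e) - of_bool (fst y = snd e))"

abbreviation row_indep :: "'a set \<Rightarrow> ('a \<Rightarrow> real ^ 'd) \<Rightarrow> ('a \<times> 'a) set \<Rightarrow> bool" where
  "row_indep V p F \<equiv> fam_indep (V \<times> UNIV) F (rig_row (coords p))"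

definition inf_motion :: "('a \<times> 'a) set \<Rightarrow> ('a \<Rightarrow> real ^ 'd) \<Rightarrow> ('a \<Rightarrow> real ^ 'd) \<Rightarrow> bool" where
  "inf_motion E p z \<longleftrightarrow> (\<forall>(u, v)\<in>E. (p u - p v) \<bullet> (z u - z v) = 0)"

lemma row_dot_coords:
  assumes "finite V" "u \<in> V" "v \<in> V"
  shows "(\<Sum>y\<in>V \<times> UNIV. rig_row (coords p) (u, v) y * coords z y) = (p u - p v) \<bullet> (z u - z v)"
proof -
  have "(\<Sum>y\<in>V \<times> UNIV. rig_row (coords p) (u, v) y * coords z y)
    = (\<Sum>i\<in>UNIV. \<Sum>w\<in>V. (p u $ i - p v $ i) * ((if w = u then z w $ i else 0) - (if w = v then z w $ i else 0)))"
    unfolding sum.cartesian_product' by (subst sum.swap) (auto simp: rig_row_def coords_def intro!: sum.cong)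
  also have "\<dots> = (\<Sum>i\<in>UNIV. (p u $ i - p v $ i) * (z u $ i - z v $ i))"
    using assms by (simp add: sum_distrib_left[symmetric] sum_subtractf)
  finally show ?thesis
    by (simp add: inner_vec_def)
qed

lemma rat_poly_fun_row:
  assumes "e \<in> V \<times> V"
  shows "rat_poly_fun (V \<times> UNIV) (\<lambda>q. rig_row q e y)"
  unfolding rig_row_def using assms
  by (intro rat_poly_fun_mult rat_poly_fun_diff rat_poly_fun_coord rat_poly_fun_const) auto

text \<open>The rows of \<open>F\<close> vanish in the columns of \<open>v\<close>. Hence these
  columns force the coefficients of the new rows to be zero, and a relation within \<open>F\<close>
  remains.\<close>

lemma row_indep_extend:
  assumes "v \<in> V" "v \<notin> S" "F \<subseteq> S \<times> S" "A \<subseteq> S" "finite F" "finite A"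
    and "fam_indep UNIV A (\<lambda>a i. (p v - p a) $ i)" "row_indep V p F"
  shows "row_indep V p (F \<union> Pair v ` A)"
  unfolding fam_indep_def
proof (intro allI impI)
  fix c assume c: "\<forall>y\<in>V \<times> UNIV. (\<Sum>e\<in>F \<union> Pair v ` A. c e * rig_row (coords p) e y) = 0"
  have split: "(\<Sum>e\<in>F \<union> Pair v ` A. c e * rig_row (coords p) e y)
    = (\<Sum>e\<in>F. c e * rig_row (coords p) e y) + (\<Sum>a\<in>A. c (v, a) * rig_row (coords p) (v, a) y)" for y
    using assms by (subst sum.union_disjoint) (auto simp: sum.reindex inj_on_def)
  have F0: "(\<Sum>e\<in>F. c e * rig_row (coords p) e (v, i)) = 0" for i
    using assms by (intro sum.neutral) (auto simp: rig_row_def)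
  have "(\<Sum>a\<in>A. c (v, a) * (p v - p a) $ i) = 0" for i
  proof -
    have "(\<Sum>a\<in>A. c (v, a) * (p v - p a) $ i) = (\<Sum>a\<in>A. c (v, a) * rig_row (coords p) (v, a) (v, i))"
      using assms by (intro sum.cong) (auto simp: rig_row_def coords_def)
    then show ?thesis
      using split[of "(v, i)"] c F0 assms(1) by simp
  qed
  then have cA: "c (v, a) = 0" if "a \<in> A" for a
    using that by (intro fam_indepD[OF assms(7), of "\<lambda>a. c (v, a)" a]) auto
  then have "(\<Sum>e\<in>F. c e * rig_row (coords p) e y) = 0" if "y \<in> V \<times> UNIV" for y
    using bspec[OF c that] split[of y] by simp
  then have "c e = 0" if "e \<in> F" for e
    using that by (intro fam_indepD[OF assms(8), of c]) auto
  then show "\<forall>e\<in>F \<union> Pair v ` A. c e = 0"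
    using cA by auto
qed

text \<open>
  With \<open>v\<close> at the midpoint of \<open>x\<close> and \<open>y\<close>, the rows of \<open>vx\<close> and \<open>vy\<close> add up to half the row
  of \<open>xy\<close>; so \<open>v\<close> contributes one more than the dimension as soon as \<open>xy\<close> is independent of \<open>F\<close>.
\<close>

lemma row_indep_extend_midpoint:
  assumes "v \<in> V" "v \<notin> S" "F \<subseteq> S \<times> S" "A \<subseteq> S" "finite F" "finite A"
    and xy: "x \<in> A" "y \<in> A" "x \<noteq> y" "(x, y) \<notin> F" "p v = (1/2) *\<^sub>R (p x + p y)"
    and A: "fam_indep UNIV (A - {y}) (\<lambda>a i. (p v - p a) $ i)"
    and F: "row_indep V p (insert (x, y) F)"
  shows "row_indep V p (F \<union> Pair v ` A)"
  unfolding fam_indep_def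
proof (intro allI impI)
  fix c assume c: "\<forall>w\<in>V \<times> UNIV. (\<Sum>e\<in>F \<union> Pair v ` A. c e * rig_row (coords p) e w) = 0"
  have split: "(\<Sum>e\<in>F \<union> Pair v ` A. c e * rig_row (coords p) e w)
    = (\<Sum>e\<in>F. c e * rig_row (coords p) e w) + (\<Sum>a\<in>A. c (v, a) * rig_row (coords p) (v, a) w)" for w
    using assms by (subst sum.union_disjoint) (auto simp: sum.reindex inj_on_def)
  have F0: "(\<Sum>e\<in>F. c e * rig_row (coords p) e (v, i)) = 0" for i
    using assms by (intro sum.neutral) (auto simp: rig_row_def)
  have A0: "(\<Sum>a\<in>A. c (v, a) * (p v - p a) $ i) = 0" for i
  proof -
    have "(\<Sum>a\<in>A. c (v, a) * (p v - p a) $ i) = (\<Sum>a\<in>A. c (v, a) * rig_row (coords p) (v, a) (v, i))"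
      using assms by (intro sum.cong) (auto simp: rig_row_def coords_def)
    then show ?thesis
      using split[of "(v, i)"] c F0 assms(1) by simp
  qed
  have xAy: "x \<in> A - {y}"
    using xy by auto
  \<comment> \<open>As \<open>p v - p y\<close> is the negative of \<open>p v - p x\<close>, the
    relation in the columns of \<open>v\<close> becomes one over \<open>A - {y}\<close>. It forces
    \<open>c (v, x) = c (v, y)\<close> and the vanishing of all other new coefficients.\<close>
  define c' where "c' = (\<lambda>a. if a = x then c (v, x) - c (v, y) else c (v, a))"
  have "(\<Sum>a\<in>A - {y}. c' a * (p v - p a) $ i) = 0" for i
  proof -
    define X where "X = (p v - p x) $ i"
    define R where "R = (\<Sum>a\<in>A - {y} - {x}. c (v, a) * (p v - p a) $ i)"
    have y: "(p v - p y) $ i = - X"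
      using xy(5) by (simp add: X_def field_simps)
    have "0 = c (v, y) * (p v - p y) $ i + (c (v, x) * X + R)"
      using sum.remove[OF assms(6) xy(2), of "\<lambda>a. c (v, a) * (p v - p a) $ i"] A0[of i]
        sum.remove[OF _ xAy, of "\<lambda>a. c (v, a) * (p v - p a) $ i"] assms(6) unfolding X_def R_def by simp
    then have zero: "0 = c (v, y) * (- X) + (c (v, x) * X + R)"
      unfolding y .
    have "(\<Sum>a\<in>A - {y}. c' a * (p v - p a) $ i)
      = c' x * X + (\<Sum>a\<in>A - {y} - {x}. c' a * (p v - p a) $ i)"
      using xAy assms(6) by (simp add: sum.remove X_def)
    moreover have "(\<Sum>a\<in>A - {y} - {x}. c' a * (p v - p a) $ i) = R"
      unfolding R_def by (intro sum.cong) (auto simp: c'_def)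
    moreover have "c' x = c (v, x) - c (v, y)"
      by (simp add: c'_def)
    ultimately have "(\<Sum>a\<in>A - {y}. c' a * (p v - p a) $ i) = (c (v, x) - c (v, y)) * X + R"
      by (simp only:)
    also have "\<dots> = 0"
      using zero by (simp add: algebra_simps)
    finally show ?thesis .
  qed
  then have c'0: "c' a = 0" if "a \<in> A - {y}" for a
    using that by (intro fam_indepD[OF A, of c']) auto
  have cx: "c (v, x) = c (v, y)"
    using c'0[OF xAy] by (simp add: c'_def)
  have ca: "c (v, a) = 0" if "a \<in> A" "a \<noteq> x" "a \<noteq> y" for a
    using c'0[of a] that by (simp add: c'_def)
  have rows: "rig_row (coords p) (v, x) w + rig_row (coords p) (v, y) w = rig_row (coords p) (x, y) w / 2" for w
  proof -
    have "x \<noteq> v" "y \<noteq> v"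
      using assms by auto
    then show ?thesis
      using xy(3,5) by (auto simp: rig_row_def coords_def field_simps split: prod.split)
  qed
  define c'' where "c'' = c((x, y) := c (v, y) / 2)"
  have "(\<Sum>e\<in>insert (x, y) F. c'' e * rig_row (coords p) e w) = 0" if "w \<in> V \<times> UNIV" for w
  proof -
    have "(\<Sum>e\<in>insert (x, y) F. c'' e * rig_row (coords p) e w)
      = c (v, y) * (rig_row (coords p) (v, x) w + rig_row (coords p) (v, y) w) + (\<Sum>e\<in>F. c'' e * rig_row (coords p) e w)"
      unfolding rows using xy(4) assms(5) by (simp add: c''_def)
    also have "(\<Sum>e\<in>F. c'' e * rig_row (coords p) e w) = (\<Sum>e\<in>F. c e * rig_row (coords p) e w)"
      using xy(4) by (intro sum.cong) (auto simp: c''_def)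
    also have "c (v, y) * (rig_row (coords p) (v, x) w + rig_row (coords p) (v, y) w)
      = (\<Sum>a\<in>{x, y}. c (v, a) * rig_row (coords p) (v, a) w)"
      using xy(3) by (simp add: cx algebra_simps)
    also have "\<dots> = (\<Sum>a\<in>A. c (v, a) * rig_row (coords p) (v, a) w)"
      using xy assms(6) ca by (intro sum.mono_neutral_left) auto
    finally show ?thesis
      using bspec[OF c that] split[of w] by simp
  qed
  then have 0: "c'' e = 0" if "e \<in> insert (x, y) F" for e
    using that by (intro fam_indepD[OF F, of c'']) auto
  have "c (v, y) = 0"
    using 0[of "(x, y)"] by (simp add: c''_def)
  moreover have "c e = 0" if "e \<in> F" for e
    using 0[of e] that xy(4) by (auto simp: c''_def split: if_splits)
  ultimately show "\<forall>e\<in>F \<union> Pair v ` A. c e = 0"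
    using cx ca by auto
qed

section \<open>Generic placements\<close>

locale generic_placement =
  fixes V :: "'a set" and p :: "'a \<Rightarrow> real ^ 'd"
  assumes finite_V: "finite V"
    and alg_indep: "algebraically_independent_over_rat (V \<times> UNIV) (coords p)"
begin

lemma row_indep_transfer:
  fixes q :: "'a \<Rightarrow> real ^ 'd"
  assumes "F \<subseteq> V \<times> V" "row_indep V q F"
  shows "row_indep V p F"
proof -
  have "finite F"
    using assms(1) finite_V finite_subset by blast
  then show ?thesis
    using assms by (intro fam_indep_transfer[OF alg_indep, where w = rig_row and q = "coords q"] rat_poly_fun_row) auto
qed

lemma general_position:
  assumes "v \<in> V" "A \<subseteq> V" "v \<notin> A" "card A \<le> CARD('d)"
  shows "fam_indep UNIV A (\<lambda>a i. (p v - p a) $ i)"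
proof -
  have finA: "finite A"
    using assms finite_V finite_subset by blast
  obtain f :: "'a \<Rightarrow> 'd" where f: "inj_on f A"
    using card_le_inj[of A "UNIV :: 'd set"] finA assms(4) by auto
  define w where "w = (\<lambda>(x :: 'a \<times> 'd \<Rightarrow> real) a i. x (v, i) - x (a, i))"
  \<comment> \<open>Special configuration: \<open>v\<close> at the origin and the points of
    \<open>A\<close> at negatives of distinct unit vectors, so that the differences are standard
    basis vectors.\<close>
  define q where "q = (\<lambda>(b, i). if b \<in> A \<and> i = f b then -1 else 0 :: real)"
  have "fam_indep UNIV A (w q)"
    unfolding fam_indep_def
  proof (intro allI impI ballI)
    fix c a assume c: "\<forall>i\<in>UNIV. (\<Sum>b\<in>A. c b * w q b i) = 0" and a: "a \<in> A"
    have "(\<Sum>b\<in>A. c b * w q b (f a)) = (\<Sum>b\<in>A. if b = a then c b else 0)"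
      using assms(3) a f by (intro sum.cong) (auto simp: w_def q_def inj_on_def)
    then show "c a = 0"
      using c a finA by simp
  qed
  then have "fam_indep UNIV A (w (coords p))"
    using finA assms by (intro fam_indep_transfer[OF alg_indep, where w = w and q = q])
      (auto simp: w_def intro!: rat_poly_fun_diff rat_poly_fun_coord)
  then show ?thesis
    by (simp add: w_def coords_def)
qed

text \<open>
  The points of \<open>D\<close>, \<open>b\<close>, \<open>b'\<close> carry an affine dependency \<open>\<kappa>\<close>, nonzero at \<open>b\<close> and at \<open>b'\<close>,
  and \<open>\<kappa> s * \<kappa> t\<close> is then an equilibrium stress of the complete graph on these points.
\<close>

lemma inf_motion_missing_edge:
  assumes "D \<subseteq> V" "card D = CARD('d)" "b \<in> V" "b' \<in> V" "b \<notin> D" "b' \<notin> D" "b \<noteq> b'"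
    and z: "\<And>s t. s \<in> insert b (insert b' D) \<Longrightarrow> t \<in> insert b (insert b' D) \<Longrightarrow> s \<noteq> t \<Longrightarrow>
        {s, t} \<noteq> {b, b'} \<Longrightarrow> (p s - p t) \<bullet> (z s - z t) = 0"
  shows "(p b - p b') \<bullet> (z b - z b') = 0"
proof -
  have finD: "finite D"
    using assms finite_V finite_subset by blast
  \<comment> \<open>The \<open>d + 1\<close> difference vectors at \<open>b\<close> are dependent in
    dimension \<open>d\<close>; this provides the affine dependency.\<close>
  have "\<not> fam_indep UNIV (insert b' D) (\<lambda>a i. (p b - p a) $ i)"
    using fam_indep_card_le[of "insert b' D" "UNIV :: 'd set"] finD assms by fastforce
  then obtain \<mu> e where mu: "\<And>i. (\<Sum>t\<in>insert b' D. \<mu> t * (p b - p t) $ i) = 0"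
    and e: "e \<in> insert b' D" "\<mu> e \<noteq> 0"
    unfolding fam_indep_def by blast
  define \<sigma> where "\<sigma> = (\<Sum>t\<in>insert b' D. \<mu> t)"
  have mu_vec: "(\<Sum>t\<in>insert b' D. \<mu> t *\<^sub>R (p b - p t)) = 0"
    using mu by (simp add: vec_eq_iff)
  then have mu_p: "(\<Sum>t\<in>insert b' D. \<mu> t *\<^sub>R p t) = \<sigma> *\<^sub>R p b"
    by (simp add: \<sigma>_def scaleR_diff_right sum_subtractf scaleR_sum_left del: sum.insert)
  have mu_b': "\<mu> b' \<noteq> 0"
  proof
    assume 0: "\<mu> b' = 0"
    then have "(\<Sum>t\<in>D. \<mu> t * (p b - p t) $ i) = 0" for i
      using mu[of i] assms finD by simp
    then have "\<mu> t = 0" if "t \<in> D" for t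
      using that assms by (intro fam_indepD[OF general_position[of b D], of \<mu>]) auto
    then show False
      using 0 e by auto
  qed
  \<comment> \<open>With \<open>\<sigma> = 0\<close> the point \<open>b\<close> would drop out,
    leaving a dependency among \<open>b'\<close> and \<open>D\<close>, against general
    position.\<close>
  have sigma: "\<sigma> \<noteq> 0"
  proof
    assume 0: "\<sigma> = 0"
    have "(\<Sum>t\<in>insert b' D. \<mu> t *\<^sub>R (p b' - p t)) = \<sigma> *\<^sub>R p b' - (\<Sum>t\<in>insert b' D. \<mu> t *\<^sub>R p t)"
      by (simp add: \<sigma>_def scaleR_diff_right sum_subtractf scaleR_sum_left del: sum.insert)
    then have "(\<Sum>t\<in>D. \<mu> t *\<^sub>R (p b' - p t)) = 0"
      using mu_p 0 assms finD by simp
    then have "(\<Sum>t\<in>D. \<mu> t * (p b' - p t) $ i) = 0" for i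
      by (simp add: vec_eq_iff)
    then have "\<mu> t = 0" if "t \<in> D" for t
      using that assms by (intro fam_indepD[OF general_position[of b' D], of \<mu>]) auto
    then have "\<sigma> = \<mu> b'"
      using assms finD by (simp add: \<sigma>_def)
    then show False
      using 0 mu_b' by simp
  qed
  define T where "T = insert b (insert b' D)"
  define \<kappa> where "\<kappa> = (\<lambda>t. if t = b then - \<sigma> else \<mu> t)"
  have finT: "finite T"
    using finD by (simp add: T_def)
  have kappa_eq: "(\<Sum>t\<in>insert b' D. \<kappa> t) = \<sigma>" "(\<Sum>t\<in>insert b' D. \<kappa> t *\<^sub>R p t) = \<sigma> *\<^sub>R p b"
    unfolding \<sigma>_def mu_p[unfolded \<sigma>_def, symmetric] using assms by (auto simp: \<kappa>_def intro!: sum.cong)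
  have "(\<Sum>t\<in>T. \<kappa> t) = 0" and kp: "(\<Sum>t\<in>T. \<kappa> t *\<^sub>R p t) = 0"
    unfolding T_def using kappa_eq assms finD
    by (simp_all add: \<kappa>_def sum.insert[of "insert b' D" b] del: sum.insert)
  \<comment> \<open>Both products vanish because \<open>\<kappa>\<close> is an affine dependency.
    Their difference expands to the stress-weighted sum over pairs, where all terms except those of
    \<open>b\<close> and \<open>b'\<close> are zero.\<close>
  then have "0 = 2 * ((\<Sum>s\<in>T. \<kappa> s * (p s \<bullet> z s)) * (\<Sum>t\<in>T. \<kappa> t)) - 2 * ((\<Sum>s\<in>T. \<kappa> s *\<^sub>R p s) \<bullet> (\<Sum>t\<in>T. \<kappa> t *\<^sub>R z t))"
    by simp
  also have "\<dots> = (\<Sum>s\<in>T. \<Sum>t\<in>T. \<kappa> s * \<kappa> t * ((p s - p t) \<bullet> (z s - z t)))"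
  proof -
    have 1: "(\<Sum>s\<in>T. \<Sum>t\<in>T. \<kappa> s * \<kappa> t * (p s \<bullet> z s)) = (\<Sum>s\<in>T. \<kappa> s * (p s \<bullet> z s)) * (\<Sum>t\<in>T. \<kappa> t)"
      by (simp only: sum_product) (simp add: mult_ac)
    have 2: "(\<Sum>s\<in>T. \<Sum>t\<in>T. \<kappa> s * \<kappa> t * (p t \<bullet> z t)) = (\<Sum>s\<in>T. \<Sum>t\<in>T. \<kappa> s * \<kappa> t * (p s \<bullet> z s))"
      by (subst sum.swap) (simp only: mult.commute)
    have 3: "(\<Sum>s\<in>T. \<Sum>t\<in>T. \<kappa> s * \<kappa> t * (p s \<bullet> z t)) = (\<Sum>s\<in>T. \<kappa> s *\<^sub>R p s) \<bullet> (\<Sum>t\<in>T. \<kappa> t *\<^sub>R z t)"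
      unfolding inner_sum_left by (simp add: inner_sum_right sum_distrib_left mult_ac)
    have 4: "(\<Sum>s\<in>T. \<Sum>t\<in>T. \<kappa> s * \<kappa> t * (p t \<bullet> z s)) = (\<Sum>s\<in>T. \<Sum>t\<in>T. \<kappa> s * \<kappa> t * (p s \<bullet> z t))"
      by (subst sum.swap) (simp only: mult.commute)
    have "(\<Sum>s\<in>T. \<Sum>t\<in>T. \<kappa> s * \<kappa> t * ((p s - p t) \<bullet> (z s - z t)))
      = (\<Sum>s\<in>T. \<Sum>t\<in>T. \<kappa> s * \<kappa> t * (p s \<bullet> z s)) + (\<Sum>s\<in>T. \<Sum>t\<in>T. \<kappa> s * \<kappa> t * (p t \<bullet> z t))
      - (\<Sum>s\<in>T. \<Sum>t\<in>T. \<kappa> s * \<kappa> t * (p s \<bullet> z t)) - (\<Sum>s\<in>T. \<Sum>t\<in>T. \<kappa> s * \<kappa> t * (p t \<bullet> z s))"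
      by (simp add: sum.distrib[symmetric] sum_subtractf[symmetric] inner_diff_left inner_diff_right algebra_simps)
    then show ?thesis
      unfolding 4 2 1 3 by simp
  qed
  also have "\<dots> = (\<Sum>(s, t)\<in>T \<times> T. \<kappa> s * \<kappa> t * ((p s - p t) \<bullet> (z s - z t)))"
    by (simp add: sum.cartesian_product)
  also have "\<dots> = (\<Sum>(s, t)\<in>{(b, b'), (b', b)}. \<kappa> s * \<kappa> t * ((p s - p t) \<bullet> (z s - z t)))"
  proof (rule sum.mono_neutral_right)
    show "\<forall>i\<in>T \<times> T - {(b, b'), (b', b)}. (case i of (s, t) \<Rightarrow> \<kappa> s * \<kappa> t * ((p s - p t) \<bullet> (z s - z t))) = 0"
    proof
      fix i assume i: "i \<in> T \<times> T - {(b, b'), (b', b)}"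
      obtain s t where st: "i = (s, t)"
        by (cases i)
      have "(p s - p t) \<bullet> (z s - z t) = 0"
      proof (cases "s = t")
        case False
        then have "{s, t} \<noteq> {b, b'}"
          using i st by (auto simp: doubleton_eq_iff)
        then show ?thesis
          using i st False by (intro z) (auto simp: T_def)
      qed simp
      then show "(case i of (s, t) \<Rightarrow> \<kappa> s * \<kappa> t * ((p s - p t) \<bullet> (z s - z t))) = 0"
        using st by simp
    qed
  qed (use finT in \<open>auto simp: T_def\<close>)
  also have "\<dots> = 2 * (\<kappa> b * \<kappa> b') * ((p b - p b') \<bullet> (z b - z b'))"
    using assms(7) by (simp add: inner_diff_left inner_diff_right algebra_simps)
  finally show ?thesis
    using sigma mu_b' assms(7) by (simp add: \<kappa>_def)
qed

end

section \<open>Closed graphs\<close>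

text \<open>For the midpoint \<open>m\<close>,
  \<open>m - p a = (p y - p a) - (p y - p x) / 2\<close>. So a relation at \<open>m\<close> becomes
  one at \<open>p y\<close> with the coefficient of \<open>x\<close> lowered by
  \<open>\<sigma> / 2\<close>. Hence only \<open>c x\<close> could survive, and then
  \<open>c x = \<sigma> / 2 = c x / 2\<close>.\<close>

lemma fam_indep_midpoint:
  fixes p :: "'a \<Rightarrow> real ^ 'd"
  assumes "finite B" "x \<in> B" "fam_indep UNIV B (\<lambda>a i. (p y - p a) $ i)"
  shows "fam_indep UNIV B (\<lambda>a i. ((1/2) *\<^sub>R (p x + p y) - p a) $ i)"
  unfolding fam_indep_def
proof (intro allI impI)
  fix c assume c: "\<forall>i\<in>UNIV. (\<Sum>a\<in>B. c a * ((1/2) *\<^sub>R (p x + p y) - p a) $ i) = 0"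
  define \<sigma> where "\<sigma> = (\<Sum>a\<in>B. c a)"
  define c' where "c' = c(x := c x - \<sigma> / 2)"
  have "(\<Sum>a\<in>B. c' a * (p y - p a) $ i) = 0" for i
  proof -
    have "(\<Sum>a\<in>B. c' a * (p y - p a) $ i)
      = c x * (p y - p x) $ i - \<sigma> / 2 * (p y - p x) $ i + (\<Sum>a\<in>B - {x}. c' a * (p y - p a) $ i)"
      using assms(1,2) by (simp add: sum.remove c'_def left_diff_distrib)
    also have "(\<Sum>a\<in>B - {x}. c' a * (p y - p a) $ i) = (\<Sum>a\<in>B - {x}. c a * (p y - p a) $ i)"
      by (intro sum.cong) (auto simp: c'_def)
    also have "c x * (p y - p x) $ i - \<sigma> / 2 * (p y - p x) $ i + \<dots>
      = (\<Sum>a\<in>B. c a * (p y - p a) $ i) - \<sigma> / 2 * (p y - p x) $ i"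
      using assms(1,2) by (simp add: sum.remove)
    also have "\<dots> = (\<Sum>a\<in>B. c a * (p y - p a) $ i - c a / 2 * (p y - p x) $ i)"
      by (simp add: \<sigma>_def sum_subtractf sum_distrib_right sum_divide_distrib)
    also have "\<dots> = (\<Sum>a\<in>B. c a * ((1/2) *\<^sub>R (p x + p y) - p a) $ i)"
      by (intro sum.cong) (auto simp: field_simps)
    finally show ?thesis
      using c by simp
  qed
  then have c': "c' a = 0" if "a \<in> B" for a
    using that by (intro fam_indepD[OF assms(3), of c']) auto
  then have ne: "c a = 0" if "a \<in> B" "a \<noteq> x" for a
    using that by (force simp: c'_def)
  then have "\<sigma> = c x"
    using assms(1,2) by (simp add: \<sigma>_def sum.remove)
  then have "c x = 0"
    using c'[OF assms(2)] by (simp add: c'_def)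
  then show "\<forall>a\<in>B. c a = 0"
    using ne by blast
qed

text \<open>Read contrapositively, \<open>edges_closed\<close> provides for each non-adjacent pair a
  motion of \<open>E\<close> that changes its distance to first order.\<close>

locale closed_graph = generic_placement V p
  for V :: "'a set" and p :: "'a \<Rightarrow> real ^ 'd" +
  fixes E :: "('a \<times> 'a) set"
  assumes edges_subset: "E \<subseteq> V \<times> V"
    and edges_sym: "(u, v) \<in> E \<Longrightarrow> (v, u) \<in> E"
    and edges_irrefl: "(u, u) \<notin> E"
    and edges_closed: "\<lbrakk>u \<in> V; v \<in> V; u \<noteq> v; \<And>z. inf_motion E p z \<Longrightarrow> (p u - p v) \<bullet> (z u - z v) = 0\<rbrakk> \<Longrightarrow> (u, v) \<in> E"
begin

definition clique :: "'a set \<Rightarrow> bool" where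
  "clique D \<longleftrightarrow> (\<forall>u\<in>D. \<forall>v\<in>D. u \<noteq> v \<longrightarrow> (u, v) \<in> E)"

lemma cliqueD: "clique D \<Longrightarrow> u \<in> D \<Longrightarrow> v \<in> D \<Longrightarrow> u \<noteq> v \<Longrightarrow> (u, v) \<in> E"
  by (simp add: clique_def)

definition nbrs :: "'a set \<Rightarrow> 'a \<Rightarrow> 'a set" where
  "nbrs W v = {a \<in> W. (v, a) \<in> E}"

text \<open>An independent \<open>F\<close> contains at most one of \<open>(u, v)\<close> and
  \<open>(v, u)\<close>, whose rows coincide, so each undirected edge counts once.\<close>

definition rk :: "'a set \<Rightarrow> nat" where
  "rk S = Max (card ` {F. F \<subseteq> E \<inter> S \<times> S \<and> row_indep V p F})"

lemma finite_edges: "finite E"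
  using edges_subset finite_V finite_subset by blast

text \<open>Among \<open>d\<close> vertices of \<open>D\<close> together with \<open>b\<close> and
  \<open>b'\<close>, only the pair \<open>b\<close>, \<open>b'\<close> may be missing, and
  \<open>inf_motion_missing_edge\<close> supplies it.\<close>

lemma clique_glue:
  assumes "D \<subseteq> V" "CARD('d) \<le> card D" "clique D" "b \<in> V" "b' \<in> V" "b \<noteq> b'"
    and adj: "\<And>a. a \<in> D \<Longrightarrow> (b, a) \<in> E" "\<And>a. a \<in> D \<Longrightarrow> (b', a) \<in> E"
  shows "(b, b') \<in> E"
proof (rule edges_closed)
  fix z assume z: "inf_motion E p z"
  obtain D0 where D0: "D0 \<subseteq> D" "card D0 = CARD('d)"
    using obtain_subset_with_card_n[OF assms(2)] by metis
  have notin: "b \<notin> D" "b' \<notin> D"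
    using adj edges_irrefl by blast+
  show "(p b - p b') \<bullet> (z b - z b') = 0"
  proof (rule inf_motion_missing_edge[of D0])
    fix s t assume st: "s \<in> insert b (insert b' D0)" "t \<in> insert b (insert b' D0)" "s \<noteq> t" "{s, t} \<noteq> {b, b'}"
    have "(s, t) \<in> E"
      using st D0(1) adj edges_sym assms(3) unfolding clique_def by blast
    then show "(p s - p t) \<bullet> (z s - z t) = 0"
      using z by (auto simp: inf_motion_def)
  qed (use assms D0 notin in auto)
qed (use assms in auto)

section \<open>Rank of induced subgraphs\<close>

lemma finite_indep_sets: "finite {F. F \<subseteq> E \<inter> S \<times> S \<and> row_indep V p F}"
  by (rule finite_subset[of _ "Pow E"]) (use finite_edges in auto)

lemma rk_ge:
  assumes "F \<subseteq> E \<inter> S \<times> S" "row_indep V p F"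
  shows "card F \<le> rk S"
  unfolding rk_def using assms finite_indep_sets[of S] by (intro Max_ge) auto

lemma rk_attained:
  obtains F where "F \<subseteq> E \<inter> S \<times> S" "row_indep V p F" "card F = rk S" "finite F"
proof -
  let ?X = "card ` {F. F \<subseteq> E \<inter> S \<times> S \<and> row_indep V p F}"
  have "finite ?X"
    using finite_indep_sets by (rule finite_imageI)
  moreover have "?X \<noteq> {}"
    using fam_indep_empty by blast
  ultimately have "rk S \<in> ?X"
    unfolding rk_def by (rule Max_in)
  then obtain F where F: "rk S = card F" "F \<in> {F. F \<subseteq> E \<inter> S \<times> S \<and> row_indep V p F}"
    by (rule imageE)
  then have "finite F"
    using finite_subset[OF _ finite_edges, of F] by simp
  then show thesis
    using F by (intro that[of F]) simp_all
qed

lemma rk_empty: "rk {} = 0"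
  by (rule rk_attained[of "{}"]) auto

text \<open>The rows are orthogonal to the translations.\<close>

lemma rk_less:
  assumes "W \<subseteq> V" "W \<noteq> {}"
  shows "rk W < CARD('d) * card W"
proof -
  obtain F where F: "F \<subseteq> E \<inter> W \<times> W" "row_indep V p F" "card F = rk W" "finite F"
    by (rule rk_attained)
  obtain w where w: "w \<in> W"
    using assms by auto
  obtain j :: 'd where True
    by simp
  have finW: "finite W"
    using assms finite_V finite_subset by blast
  \<comment> \<open>In direction \<open>j\<close> the entries of each row sum to zero over
    \<open>W\<close>, so the omitted column is determined by the others; omitting it makes the bound
    strict.\<close>
  let ?X = "W \<times> UNIV - {(w, j)}"
  have "fam_indep ?X F (rig_row (coords p))"
    unfolding fam_indep_def
  proof (intro allI impI ballI)
    fix c e assume c: "\<forall>y\<in>?X. (\<Sum>e\<in>F. c e * rig_row (coords p) e y) = 0" and e: "e \<in> F"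
    have "(\<Sum>e\<in>F. c e * rig_row (coords p) e (w, j)) = (\<Sum>u\<in>W. \<Sum>e\<in>F. c e * rig_row (coords p) e (u, j))"
      using c sum.remove[OF finW w, of "\<lambda>u. \<Sum>e\<in>F. c e * rig_row (coords p) e (u, j)"] by simp
    also have "\<dots> = (\<Sum>e\<in>F. c e * (\<Sum>u\<in>W. rig_row (coords p) e (u, j)))"
      by (subst sum.swap) (simp add: sum_distrib_left)
    also have "\<dots> = 0"
    proof (intro sum.neutral ballI)
      fix e assume "e \<in> F"
      then have "fst e \<in> W" "snd e \<in> W"
        using F by auto
      then show "c e * (\<Sum>u\<in>W. rig_row (coords p) e (u, j)) = 0"
        using finW by (simp add: rig_row_def sum_distrib_left[symmetric] sum_subtractf of_bool_def)
    qed
    finally have wj: "(\<Sum>e\<in>F. c e * rig_row (coords p) e (w, j)) = 0" .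
    have "(\<Sum>e\<in>F. c e * rig_row (coords p) e y) = 0" for y
    proof (cases "y \<in> W \<times> UNIV")
      case True
      then show ?thesis
        using wj c by (cases "y = (w, j)") auto
    next
      case False
      then have "fst y \<notin> W"
        by (cases y) auto
      then have "rig_row (coords p) e y = 0" if "e \<in> F" for e
        using F(1) that by (auto simp: rig_row_def)
      then show ?thesis
        by simp
    qed
    then show "c e = 0"
      using e by (intro fam_indepD[OF F(2), of c]) auto
  qed
  then have "card F \<le> card ?X"
    using F finW by (intro fam_indep_card_le) auto
  also have "card ?X = card W * CARD('d) - 1"
    using w finW by (simp add: card_cartesian_product)
  also have "\<dots> < card W * CARD('d)"
    using w finW by (intro diff_less) (auto simp: card_gt_0_iff)
  finally show ?thesis
    using F(3) by (simp add: mult.commute)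
qed

text \<open>Up to \<open>d\<close> neighbours are in general position with \<open>v\<close>, so
  \<open>row_indep_extend\<close> applies to their edges.\<close>

lemma rk_insert_ge:
  assumes "S \<subseteq> V" "v \<in> V" "v \<notin> S"
  shows "rk S + min CARD('d) (card (nbrs S v)) \<le> rk (insert v S)"
proof -
  obtain F where F: "F \<subseteq> E \<inter> S \<times> S" "row_indep V p F" "card F = rk S" "finite F"
    by (rule rk_attained)
  obtain A where A: "A \<subseteq> nbrs S v" "card A = min CARD('d) (card (nbrs S v))"
    using obtain_subset_with_card_n[OF min.cobounded2[of "CARD('d)" "card (nbrs S v)"]] by metis
  have AS: "A \<subseteq> S"
    using A by (auto simp: nbrs_def)
  have finA: "finite A"
    using finite_subset[OF subset_trans[OF AS assms(1)] finite_V] .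
  have "fam_indep UNIV A (\<lambda>a i. (p v - p a) $ i)"
    using AS A assms by (intro general_position) auto
  then have "row_indep V p (F \<union> Pair v ` A)"
    using assms F AS finA by (intro row_indep_extend[of v V S]) auto
  moreover have "F \<union> Pair v ` A \<subseteq> E \<inter> insert v S \<times> insert v S"
    using F A by (auto simp: nbrs_def)
  ultimately have "card (F \<union> Pair v ` A) \<le> rk (insert v S)"
    by (intro rk_ge)
  moreover have "card (F \<union> Pair v ` A) = card F + card A"
    using F finA assms by (subst card_Un_disjoint) (auto simp: card_image inj_on_def)
  ultimately show ?thesis
    using F A by simp
qed

text \<open>With \<open>v\<close> moved to the midpoint of two non-adjacent neighbours,
  \<open>d + 1\<close> edges at \<open>v\<close> can be added independently, and genericity carries
  this back to \<open>p\<close>.\<close>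

lemma rk_insert_ge_nonclique:
  assumes "S \<subseteq> V" "v \<in> V" "v \<notin> S" "card (nbrs S v) \<ge> CARD('d) + 1" "\<not> clique (nbrs S v)"
  shows "rk S + CARD('d) + 1 \<le> rk (insert v S)"
proof -
  obtain F where F: "F \<subseteq> E \<inter> S \<times> S" "row_indep V p F" "card F = rk S" "finite F"
    by (rule rk_attained)
  obtain x y where xy: "x \<in> nbrs S v" "y \<in> nbrs S v" "x \<noteq> y" "(x, y) \<notin> E"
    using assms(5) unfolding clique_def by blast
  have xyS: "x \<in> S" "y \<in> S"
    using xy by (auto simp: nbrs_def)
  have finN: "finite (nbrs S v)"
    using assms(1) finite_V by (intro finite_subset[of "nbrs S v" V]) (auto simp: nbrs_def)
  have "CARD('d) - 1 \<le> card (nbrs S v - {x, y})"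
    using assms(4) xy finN by (simp add: card_Diff_subset)
  from obtain_subset_with_card_n[OF this]
  obtain A0 where A0: "A0 \<subseteq> nbrs S v - {x, y}" "card A0 = CARD('d) - 1"
    by metis
  define A where "A = insert x (insert y A0)"
  have finA0: "finite A0"
    using A0 finN finite_subset by blast
  have d0: "CARD('d) > 0"
    by simp
  have A: "A \<subseteq> nbrs S v" "card A = CARD('d) + 1" "finite A" "x \<in> A" "y \<in> A"
    using A0 xy finA0 d0 unfolding A_def by (auto simp: card_insert_if)
  have AS: "A \<subseteq> S"
    using A by (auto simp: nbrs_def)
  \<comment> \<open>This motion is orthogonal to the rows of \<open>F\<close> but not to that of
    \<open>(x, y)\<close>.\<close>
  obtain z where z: "inf_motion E p z" "(p x - p y) \<bullet> (z x - z y) \<noteq> 0"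
    using edges_closed[of x y] xy xyS assms(1) by blast
  have "row_indep V p (insert (x, y) F)"
  proof (rule fam_indep_insert_dual[where z = "coords z"])
    fix e assume "e \<in> F"
    then obtain u w where "e = (u, w)" "(u, w) \<in> E" "u \<in> V" "w \<in> V"
      using F edges_subset by (cases e) auto
    then show "(\<Sum>q\<in>V \<times> UNIV. rig_row (coords p) e q * coords z q) = 0"
      using row_dot_coords[OF finite_V, of u w p z] z(1) by (auto simp: inf_motion_def)
  next
    show "(\<Sum>q\<in>V \<times> UNIV. rig_row (coords p) (x, y) q * coords z q) \<noteq> 0"
      using row_dot_coords[OF finite_V, of x y p z] z(2) xyS assms(1) by (simp add: subset_iff)
  qed (use F xy in auto)
  \<comment> \<open>Moving \<open>v\<close> changes none of the rows in
    \<open>insert (x, y) F\<close>, since these pairs avoid \<open>v\<close>.\<close>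
  moreover define p' where "p' = p(v := (1/2) *\<^sub>R (p x + p y))"
  moreover have "rig_row (coords p) e q = rig_row (coords p') e q" if "e \<in> insert (x, y) F" for e q
  proof -
    have "fst e \<noteq> v" "snd e \<noteq> v"
      using that F xyS assms by auto
    then show ?thesis
      by (simp add: rig_row_def coords_def p'_def)
  qed
  ultimately have F': "row_indep V p' (insert (x, y) F)"
    by (subst fam_indep_cong[where w' = "rig_row (coords p)"]) auto
  have "fam_indep UNIV (A - {y}) (\<lambda>a i. (p y - p a) $ i)"
    using A AS assms xyS by (intro general_position) auto
  then have "fam_indep UNIV (A - {y}) (\<lambda>a i. ((1/2) *\<^sub>R (p x + p y) - p a) $ i)"
    using A xy by (intro fam_indep_midpoint) auto
  moreover have "p' a = p a" if "a \<in> A" for a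
    using that AS assms(3) by (auto simp: p'_def)
  then have "(p' v - p' a) $ i = ((1/2) *\<^sub>R (p x + p y) - p a) $ i" if "a \<in> A - {y}" for a i
    using that by (simp add: p'_def)
  ultimately have A': "fam_indep UNIV (A - {y}) (\<lambda>a i. (p' v - p' a) $ i)"
    using fam_indep_cong[of "A - {y}" UNIV "\<lambda>a i. (p' v - p' a) $ i" "\<lambda>a i. ((1/2) *\<^sub>R (p x + p y) - p a) $ i"]
    by blast
  have "x \<noteq> v" "y \<noteq> v"
    using xyS assms by auto
  then have "row_indep V p' (F \<union> Pair v ` A)"
    using assms F AS A xy A' F'
    by (intro row_indep_extend_midpoint[of v V S F A x y p']) (auto simp: p'_def)
  moreover have sub: "F \<union> Pair v ` A \<subseteq> E \<inter> insert v S \<times> insert v S"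
    using F A by (auto simp: nbrs_def)
  ultimately have "row_indep V p (F \<union> Pair v ` A)"
    using edges_subset by (intro row_indep_transfer) auto
  then have "card (F \<union> Pair v ` A) \<le> rk (insert v S)"
    using sub by (intro rk_ge)
  moreover have "card (F \<union> Pair v ` A) = card F + card A"
    using F A(3) assms by (subst card_Un_disjoint) (auto simp: card_image inj_on_def)
  ultimately show ?thesis
    using F A by simp
qed

text \<open>If no neighbourhood were a clique, each vertex would gain at least \<open>d\<close> on
  average by \<open>order_weight_sum_ge\<close>; telescoping would contradict
  \<open>rk_less\<close>.\<close>

lemma simplicial_vertex_exists:
  assumes "W \<subseteq> V" "W \<noteq> {}" "\<And>v. v \<in> W \<Longrightarrow> CARD('d) * (CARD('d) + 1) \<le> card (nbrs W v)"
  shows "\<exists>v\<in>W. clique (nbrs W v)"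
proof (rule ccontr)
  assume no: "\<not> (\<exists>v\<in>W. clique (nbrs W v))"
  let ?d = "CARD('d)"
  have finW: "finite W"
    using assms finite_V finite_subset by blast
  \<comment> \<open>A lower bound for the rank gain that depends only on the neighbours inserted
    earlier.\<close>
  define g where "g = (\<lambda>B. if card B \<ge> ?d + 1 \<and> \<not> clique B then real (?d + 1) else real (min ?d (card B)))"
  have vertex: "real ?d \<le> (\<Sum>S\<in>Pow (W - {v}). order_weight (card S) (card W - 1 - card S) * (real (rk (insert v S)) - real (rk S)))"
    if v: "v \<in> W" for v
  proof -
    let ?N = "nbrs W v"
    have NU: "?N \<subseteq> W - {v}"
      using edges_irrefl by (auto simp: nbrs_def)
    have finN: "finite ?N"
      using NU finW finite_subset by blast
    have "real ?d \<le> (\<Sum>B\<in>Pow ?N. order_weight (card B) (card ?N - card B) * g B)"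
    proof (rule order_weight_sum_ge[where Q = "\<lambda>B. \<not> clique B"])
      \<comment> \<open>If both deletions left cliques, these would share the at least
        \<open>d\<close> vertices of \<open>B - {b, c}\<close>, and gluing would make
        \<open>B\<close> a clique.\<close>
      fix B b c assume B: "B \<subseteq> ?N" "\<not> clique B" "card B \<ge> ?d + 2" "b \<in> B" "c \<in> B" "b \<noteq> c"
      show "\<not> clique (B - {b}) \<or> \<not> clique (B - {c})"
      proof (rule ccontr)
        assume "\<not> ?thesis"
        then have cl: "clique (B - {b})" "clique (B - {c})"
          by auto
        have BV: "B \<subseteq> V"
          using B(1) assms(1) by (auto simp: nbrs_def)
        have "finite B"
          using B finN finite_subset by blast
        then have "?d \<le> card (B - {b, c})"
          using B by (simp add: card_Diff_subset)
        then have "(b, c) \<in> E"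
        proof (rule clique_glue[rotated])
          show "clique (B - {b, c})"
            using cl(1) by (simp add: clique_def)
          show "(b, a) \<in> E" if "a \<in> B - {b, c}" for a
            by (rule cliqueD[OF cl(2)]) (use that B(4,6) in auto)
          show "(c, a) \<in> E" if "a \<in> B - {b, c}" for a
            by (rule cliqueD[OF cl(1)]) (use that B(5,6) in auto)
        qed (use B BV in auto)
        have "clique B"
          unfolding clique_def
        proof (intro ballI impI)
          fix s t assume st: "s \<in> B" "t \<in> B" "s \<noteq> t"
          show "(s, t) \<in> E"
          proof (cases "{s, t} = {b, c}")
            case True
            then show ?thesis
              using \<open>(b, c) \<in> E\<close> edges_sym by (auto simp: doubleton_eq_iff)
          next
            case False
            then have "s \<noteq> b \<and> t \<noteq> b \<or> s \<noteq> c \<and> t \<noteq> c"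
              using st(3) B(6) by auto
            then show ?thesis
              using cliqueD[OF cl(1), of s t] cliqueD[OF cl(2), of s t] st by auto
          qed
        qed
        then show False
          using B by simp
      qed
    qed (use finN no v assms(3) in \<open>auto simp: g_def\<close>)
    also have "\<dots> = (\<Sum>S\<in>Pow (W - {v}). order_weight (card S) (card (W - {v}) - card S) * g (S \<inter> ?N))"
      using NU finW by (intro order_weight_marginal[symmetric]) auto
    also have "\<dots> \<le> (\<Sum>S\<in>Pow (W - {v}). order_weight (card S) (card W - 1 - card S) * (real (rk (insert v S)) - real (rk S)))"
    proof (intro sum_mono)
      fix S assume S: "S \<in> Pow (W - {v})"
      then have int: "S \<inter> ?N = nbrs S v"
        by (auto simp: nbrs_def)
      have SV: "S \<subseteq> V" "v \<in> V" "v \<notin> S"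
        using S assms v by auto
      have "g (nbrs S v) \<le> real (rk (insert v S)) - real (rk S)"
        using rk_insert_ge[OF SV] rk_insert_ge_nonclique[OF SV] by (auto simp: g_def)
      then show "order_weight (card S) (card (W - {v}) - card S) * g (S \<inter> ?N)
        \<le> order_weight (card S) (card W - 1 - card S) * (real (rk (insert v S)) - real (rk S))"
        unfolding int using v finW by (simp add: mult_left_mono order_weight_nonneg)
    qed
    finally show ?thesis .
  qed
  have "real (?d * card W) = (\<Sum>v\<in>W. real ?d)"
    by simp
  also have "\<dots> \<le> (\<Sum>v\<in>W. \<Sum>S\<in>Pow (W - {v}). order_weight (card S) (card W - 1 - card S) * (real (rk (insert v S)) - real (rk S)))"
    by (intro sum_mono vertex)
  also have "\<dots> = real (rk W) - real (rk {})"
    using finW by (rule order_weight_telescope)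
  finally have "?d * card W \<le> rk W"
    unfolding rk_empty of_nat_0 diff_zero of_nat_le_iff .
  then show False
    using rk_less[OF assms(1,2)] by simp
qed

text \<open>Connectivity is phrased by splits of the remaining vertices into two parts; this is
  convenient for vertex deletion and evidently survives adding edges.\<close>

definition cut_connected :: "nat \<Rightarrow> 'a set \<Rightarrow> bool" where
  "cut_connected k W \<longleftrightarrow> card W > k \<and>
     (\<forall>S A B. S \<subseteq> W \<longrightarrow> card S < k \<longrightarrow> A \<noteq> {} \<longrightarrow> B \<noteq> {} \<longrightarrow> A \<inter> B = {} \<longrightarrow> A \<union> B = W - S \<longrightarrow>
        (\<exists>a\<in>A. \<exists>b\<in>B. (a, b) \<in> E))"

lemma cut_connectedD:
  assumes "cut_connected k W" "S \<subseteq> W" "card S < k" "A \<noteq> {}" "B \<noteq> {}" "A \<inter> B = {}" "A \<union> B = W - S"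
  shows "\<exists>a\<in>A. \<exists>b\<in>B. (a, b) \<in> E"
  using assms unfolding cut_connected_def by meson

text \<open>Otherwise fewer than \<open>k\<close> neighbours separate \<open>v\<close> from the
  rest, which is nonempty because \<open>card W > k\<close>.\<close>

lemma cut_connected_degree:
  assumes "cut_connected k W" "finite W" "v \<in> W"
  shows "k \<le> card (nbrs W v)"
proof (rule ccontr)
  assume less: "\<not> k \<le> card (nbrs W v)"
  have sub: "nbrs W v \<subseteq> W - {v}"
    using edges_irrefl by (auto simp: nbrs_def)
  have "card (insert v (nbrs W v)) \<le> k"
    using less card_insert_le_m1[of "Suc (card (nbrs W v))" "nbrs W v" v] by simp
  then have "W \<noteq> insert v (nbrs W v)"
    using assms unfolding cut_connected_def by force
  then have "W - nbrs W v - {v} \<noteq> {}"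
    using sub assms by auto
  then have "\<exists>a\<in>{v}. \<exists>b\<in>W - nbrs W v - {v}. (a, b) \<in> E"
    using assms less sub by (intro cut_connectedD[of k W "nbrs W v"]) auto
  then show False
    by (auto simp: nbrs_def)
qed

text \<open>Put \<open>v\<close> on either side of a split of the smaller set. If both resulting
  crossing edges use \<open>v\<close>, then \<open>v\<close> has neighbours on both sides, and these
  are adjacent; otherwise some edge already crosses.\<close>

lemma cut_connected_remove_simplicial:
  assumes "cut_connected k W" "finite W" "v \<in> W" "clique (nbrs W v)" "card W > k + 1"
  shows "cut_connected k (W - {v})"
  unfolding cut_connected_def
proof (intro conjI allI impI)
  show "k < card (W - {v})"
    using assms by simp
next
  fix S A B
  assume S: "S \<subseteq> W - {v}" "card S < k" and AB: "A \<noteq> {}" "B \<noteq> {}" "A \<inter> B = {}" "A \<union> B = W - {v} - S"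
  have "v \<notin> A" "v \<notin> B" "v \<notin> S" "A \<subseteq> W" "B \<subseteq> W"
    using S AB by auto
  have "insert v A \<union> B = W - S" "A \<union> insert v B = W - S"
    using AB(4) \<open>v \<notin> S\<close> assms(3) by auto
  then have "\<exists>a\<in>insert v A. \<exists>b\<in>B. (a, b) \<in> E" "\<exists>a\<in>A. \<exists>b\<in>insert v B. (a, b) \<in> E"
    using S AB \<open>v \<notin> A\<close> \<open>v \<notin> B\<close> by (auto intro!: cut_connectedD[OF assms(1), of S] simp del: insert_iff bex_simps)
  then show "\<exists>a\<in>A. \<exists>b\<in>B. (a, b) \<in> E"
  proof (elim bexE insertE)
    fix a b b' a'
    assume "b \<in> B" "(a, b) \<in> E" "a' \<in> A" "(a', b') \<in> E" "a = v" "b' = v"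
    then have "b \<in> nbrs W v" "a' \<in> nbrs W v" "a' \<noteq> b"
      using \<open>A \<subseteq> W\<close> \<open>B \<subseteq> W\<close> AB(3) edges_sym by (auto simp: nbrs_def)
    then show ?thesis
      using assms(4) \<open>b \<in> B\<close> \<open>a' \<in> A\<close> unfolding clique_def by blast
  qed blast+
qed

text \<open>By induction, deleting a vertex \<open>v\<close> with clique neighbourhood leaves a
  clique. Every other vertex is then adjacent to the at least \<open>d\<close> neighbours of
  \<open>v\<close>, apart from itself if it is one, so \<open>clique_glue\<close> adds the missing
  edges at \<open>v\<close>.\<close>

lemma cut_connected_imp_clique:
  assumes "W \<subseteq> V" "cut_connected (CARD('d) * (CARD('d) + 1)) W"
  shows "clique W"
  using assms
proof (induction "card W" arbitrary: W rule: less_induct)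
  case less
  let ?k = "CARD('d) * (CARD('d) + 1)"
  have finW: "finite W"
    using less.prems finite_V finite_subset by blast
  have deg: "?k \<le> card (nbrs W v)" if "v \<in> W" for v
    using cut_connected_degree[OF less.prems(2) finW that] .
  have sub: "nbrs W v \<subseteq> W - {v}" for v
    using edges_irrefl by (auto simp: nbrs_def)
  show ?case
  proof (cases "card W = ?k + 1")
    \<comment> \<open>At the minimal size the degree bound already forces all edges; a deletion
      would violate the size condition of \<open>cut_connected\<close>.\<close>
    case True
    have "nbrs W v = W - {v}" if "v \<in> W" for v
      using sub[of v] deg[OF that] True that finW by (intro card_seteq) auto
    then show ?thesis
      unfolding clique_def nbrs_def by blast
  next
    case False
    then have big: "card W > ?k + 1"
      using less.prems by (auto simp: cut_connected_def)
    then have "W \<noteq> {}"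
      by auto
    then obtain v where v: "v \<in> W" "clique (nbrs W v)"
      using simplicial_vertex_exists[OF less.prems(1)] deg by blast
    have "clique (W - {v})"
    proof (rule less.hyps)
      show "card (W - {v}) < card W"
        using v finW by (intro psubset_card_mono) auto
      show "cut_connected ?k (W - {v})"
        using cut_connected_remove_simplicial[OF less.prems(2) finW v big] .
    qed (use less.prems in auto)
    moreover have "(v, w) \<in> E" if w: "w \<in> W" "w \<noteq> v" for w
    proof (cases "w \<in> nbrs W v")
      case False
      have "CARD('d) \<le> card (nbrs W v)"
        using deg[OF v(1)] by (simp add: le_trans[of _ "CARD('d) * (CARD('d) + 1)"])
      then show ?thesis
      proof (rule clique_glue[rotated])
        fix a assume a: "a \<in> nbrs W v"
        then show "(v, a) \<in> E"
          by (simp add: nbrs_def)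
        show "(w, a) \<in> E"
          by (rule cliqueD[OF \<open>clique (W - {v})\<close>]) (use a sub[of v] w False in auto)
      qed (use v w less.prems(1) in \<open>auto simp: nbrs_def\<close>)
    qed (simp add: nbrs_def)
    ultimately show ?thesis
      unfolding clique_def using edges_sym by (metis Diff_iff empty_iff insert_iff)
  qed
qed

end

section \<open>Rigidity\<close>

text \<open>Without a crossing edge, a path that starts in \<open>A\<close> stays in
  \<open>A\<close>; symmetrising adds no arcs because \<open>G\<close> is symmetric.\<close>

lemma connected_imp_cut_edge:
  assumes "pair_graph G" "Digraph_Component.connected (with_proj G \<restriction> U)"
    and "A \<noteq> {}" "B \<noteq> {}" "A \<inter> B = {}" "A \<union> B = U"
  shows "\<exists>a\<in>A. \<exists>b\<in>B. (a, b) \<in> parcs G"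
proof (rule ccontr)
  assume no: "\<not> ?thesis"
  interpret pair_graph G
    by fact
  let ?H = "mk_symmetric (with_proj G \<restriction> U)"
  have arcs: "parcs ?H \<subseteq> parcs G \<inter> U \<times> U"
    using pair_sym_arcs by (auto simp: mk_symmetric_def symmetric_def dest: symD)
  obtain a b where ab: "a \<in> A" "b \<in> B"
    using assms by auto
  have "a \<rightarrow>\<^sup>*\<^bsub>with_proj ?H\<^esub> b"
    using assms ab unfolding Digraph_Component.connected_def strongly_connected_def
    by (auto simp: mk_symmetric_def)
  then have "(a, b) \<in> (parcs ?H)\<^sup>*"
    using reachable_rtranclI by fastforce
  then have "b \<in> A"
  proof (induction rule: rtrancl_induct)
    case (step u v)
    then have "(u, v) \<in> parcs G" "v \<in> U"
      using arcs by auto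
    then show ?case
      using no step.IH assms(6) by auto
  qed (rule ab)
  then show False
    using ab assms(5) by auto
qed

text \<open>
  If \<open>q\<close> is equivalent to \<open>p\<close>, then \<open>q - p\<close> is an infinitesimal motion at \<open>(p + q) / 2\<close>, where the
  independent rows at \<open>p\<close> are still independent if \<open>q\<close> is close to \<open>p\<close>; there is no need for the
  implicit function theorem.
\<close>

lemma (in generic_placement) inf_rigid_imp_rigid:
  assumes "V = pverts G" "parcs G \<subseteq> V \<times> V"
    and rigid: "\<And>z u v. inf_motion (parcs G) p z \<Longrightarrow> u \<in> V \<Longrightarrow> v \<in> V \<Longrightarrow> (p u - p v) \<bullet> (z u - z v) = 0"
  shows "rigid_framework G p"
proof (rule ccontr)
  assume "\<not> ?thesis"
  then have "\<forall>\<epsilon>>0. \<exists>q. equivalent_frameworks G p q \<and> (\<forall>v\<in>V. norm (p v - q v) < \<epsilon>) \<and> \<not> congruent_frameworks G p q"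
    unfolding rigid_framework_def assms(1) by blast
  then have "\<forall>n. \<exists>q. equivalent_frameworks G p q \<and> (\<forall>v\<in>V. norm (p v - q v) < 1 / real (Suc n)) \<and> \<not> congruent_frameworks G p q"
    by simp
  then obtain q where q: "\<And>n. equivalent_frameworks G p (q n)" "\<And>n v. v \<in> V \<Longrightarrow> norm (p v - q n v) < 1 / real (Suc n)"
    "\<And>n. \<not> congruent_frameworks G p (q n)"
    by metis
  define m where "m = (\<lambda>n v. (1/2) *\<^sub>R (p v + q n v))"
  have fin: "finite (parcs G)"
    using assms(2) finite_V finite_subset by blast
  let ?\<F> = "{F. F \<subseteq> parcs G \<and> row_indep V p F}"
  have "finite ?\<F>"
    by (rule finite_subset[of _ "Pow (parcs G)"]) (use fin in auto)
  moreover have "{} \<in> ?\<F>"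
    by simp
  \<comment> \<open>By maximality of \<open>F\<close>, a vector orthogonal to its rows is orthogonal
    to every edge row at \<open>p\<close>.\<close>
  ultimately obtain F where F: "F \<in> ?\<F>" "\<forall>F'\<in>?\<F>. F \<subseteq> F' \<longrightarrow> F = F'"
    by (rule finite_has_maximal2[THEN bexE]) (elim conjE)
  have finF: "finite F"
    using F(1) finite_subset[OF _ fin] by simp
  have FV: "F \<subseteq> V \<times> V"
    using F(1) assms(2) by auto
  \<comment> \<open>\<open>D\<close> certifies independence and is nonzero at \<open>p\<close>,
    hence also at the midpoints \<open>m n\<close> for large \<open>n\<close>.\<close>
  obtain D where D: "rat_poly_fun (V \<times> UNIV) D" "D (coords p) \<noteq> 0"
    "\<And>x. D x \<noteq> 0 \<Longrightarrow> fam_indep (V \<times> UNIV) F (rig_row x)"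
    using fam_indep_generic[of F "V \<times> UNIV" "V \<times> UNIV" rig_row "coords p"] finF FV F(1) rat_poly_fun_row
    by blast
  have "(\<lambda>n. coords (m n) y) \<longlonglongrightarrow> coords p y" if y: "y \<in> V \<times> UNIV" for y
  proof -
    obtain v i where vi: "y = (v, i)" "v \<in> V"
      using y by auto
    have "(\<lambda>n. p v - q n v) \<longlonglongrightarrow> 0"
    proof (rule Lim_null_comparison)
      show "\<forall>\<^sub>F n in sequentially. norm (p v - q n v) \<le> 1 / real (Suc n)"
        using q(2)[OF vi(2)] by (simp add: less_imp_le)
      show "(\<lambda>n. 1 / real (Suc n)) \<longlonglongrightarrow> 0"
        using LIMSEQ_inverse_real_of_nat by (simp add: inverse_eq_divide)
    qed
    then have "(\<lambda>n. p v - (1/2) *\<^sub>R (p v - q n v)) \<longlonglongrightarrow> p v - (1/2) *\<^sub>R 0"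
      by (intro tendsto_intros)
    moreover have "p v - (1/2) *\<^sub>R (p v - q n v) = m n v" for n
      by (simp add: m_def vec_eq_iff field_simps)
    ultimately have "(\<lambda>n. m n v) \<longlonglongrightarrow> p v"
      by simp
    then show ?thesis
      by (simp add: coords_def vi(1) tendsto_vec_nth)
  qed
  then have "(\<lambda>n. D (coords (m n))) \<longlonglongrightarrow> D (coords p)"
    by (intro rat_poly_fun_tendsto[OF D(1)])
  then have "\<forall>\<^sub>F n in sequentially. D (coords (m n)) \<noteq> 0"
    using D(2) by (rule tendsto_imp_eventually_ne)
  then obtain n where "D (coords (m n)) \<noteq> 0"
    by (auto simp: eventually_sequentially)
  then have Fm: "row_indep V (m n) F"
    by (rule D(3))
  define z where "z = (\<lambda>v. q n v - p v)"
  have dot: "(m n u - m n v) \<bullet> (z u - z v) = ((norm (q n u - q n v))\<^sup>2 - (norm (p u - p v))\<^sup>2) / 2" for u v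
    by (simp add: m_def z_def power2_norm_eq_inner inner_diff_left inner_diff_right inner_add_left inner_add_right inner_commute algebra_simps)
  have zG: "(m n u - m n v) \<bullet> (z u - z v) = 0" if "(u, v) \<in> parcs G" for u v
    using q(1)[of n] that by (auto simp: dot equivalent_frameworks_def)
  obtain u v where uv: "u \<in> V" "v \<in> V" "norm (p u - p v) \<noteq> norm (q n u - q n v)"
    using q(3)[of n] by (auto simp: congruent_frameworks_def assms(1))
  then have zuv: "(m n u - m n v) \<bullet> (z u - z v) \<noteq> 0"
    by (simp add: dot)
  have uvF: "(u, v) \<notin> F"
    using zG zuv F(1) by auto
  \<comment> \<open>At \<open>m n\<close> the difference \<open>z\<close> is orthogonal to the rows
    of \<open>F\<close> but not to that of \<open>(u, v)\<close>; the resulting independence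
    transfers to the generic \<open>p\<close>.\<close>
  have "row_indep V (m n) (insert (u, v) F)"
  proof (rule fam_indep_insert_dual[where z = "coords z"])
    fix e assume e: "e \<in> F"
    then obtain a b where ab: "e = (a, b)" "a \<in> V" "b \<in> V" "(a, b) \<in> parcs G"
      using F(1) FV by (cases e) auto
    then show "(\<Sum>y\<in>V \<times> UNIV. rig_row (coords (m n)) e y * coords z y) = 0"
      using row_dot_coords[OF finite_V ab(2,3), of "m n" z] zG[OF ab(4)] by simp
  next
    show "(\<Sum>y\<in>V \<times> UNIV. rig_row (coords (m n)) (u, v) y * coords z y) \<noteq> 0"
      using row_dot_coords[OF finite_V uv(1,2), of "m n" z] zuv by simp
  qed (use Fm finF uvF in auto)
  then have uv_indep: "row_indep V p (insert (u, v) F)"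
    using FV uv by (intro row_indep_transfer) auto
  have "finite (V \<times> (UNIV :: 'd set))"
    using finite_V by simp
  \<comment> \<open>Duality at \<open>p\<close> gives a vector orthogonal to \<open>F\<close> but
    not to the row of \<open>(u, v)\<close>. It is a motion of \<open>G\<close> by maximality of
    \<open>F\<close>, contradicting \<open>rigid\<close>.\<close>
  from fam_indep_dual[OF finF this uvF uv_indep]
  obtain y where y: "\<forall>e\<in>F. (\<Sum>x\<in>V \<times> UNIV. rig_row (coords p) e x * y x) = 0"
    "(\<Sum>x\<in>V \<times> UNIV. rig_row (coords p) (u, v) x * y x) \<noteq> 0"
    by (elim exE conjE)
  define z' where "z' = (\<lambda>v. \<chi> i. y (v, i))"
  have y_eq: "y = coords z'"
    by (auto simp: coords_def z'_def)
  have "inf_motion (parcs G) p z'"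
    unfolding inf_motion_def
  proof (rule ballI, clarify)
    fix a b assume ab: "(a, b) \<in> parcs G"
    then have abV: "a \<in> V" "b \<in> V"
      using assms(2) by auto
    show "(p a - p b) \<bullet> (z' a - z' b) = 0"
    proof (rule ccontr)
      assume "(p a - p b) \<bullet> (z' a - z' b) \<noteq> 0"
      then have ne: "(\<Sum>x\<in>V \<times> UNIV. rig_row (coords p) (a, b) x * y x) \<noteq> 0"
        unfolding y_eq row_dot_coords[OF finite_V abV] .
      then have "(a, b) \<notin> F"
        using y(1) by blast
      then have "row_indep V p (insert (a, b) F)"
        using F(1) finF y(1) ne by (intro fam_indep_insert_dual[where z = y]) auto
      then have "F = insert (a, b) F"
        using F(1) ab by (intro F(2)[rule_format]) auto
      then show False
        using \<open>(a, b) \<notin> F\<close> by blast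
    qed
  qed
  then have "(p u - p v) \<bullet> (z' u - z' v) = 0"
    using uv by (intro rigid)
  then show False
    using y(2) unfolding y_eq row_dot_coords[OF finite_V uv(1,2)] by simp
qed

theorem theorem1p1:
  fixes G :: "'a pair_pre_digraph"
  assumes "pair_graph G"
    and "k_connected (CARD('d::finite) * (CARD('d) + 1)) G"
  shows "rigid_graph TYPE('d) G"
proof -
  interpret G: pair_graph G
    by fact
  let ?k = "CARD('d) * (CARD('d) + 1)"
  define V where "V = pverts G"
  have finV: "finite V"
    unfolding V_def by (rule G.pair_finite_verts)
  have arcs: "parcs G \<subseteq> V \<times> V"
    unfolding V_def using G.arc_fst_in_verts G.arc_snd_in_verts by fastforce
  obtain x :: "'a \<times> 'd \<Rightarrow> real" where x: "algebraically_independent_over_rat (V \<times> UNIV) x"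
    using alg_independent_exists[of "V \<times> (UNIV :: 'd set)"] finV by auto
  define p :: "'a \<Rightarrow> real ^ 'd" where "p = (\<lambda>v. \<chi> i. x (v, i))"
  have x_eq: "coords p = x"
    by (auto simp: coords_def p_def)
  interpret generic_placement V p
    using finV x by unfold_locales (simp_all add: x_eq)
  define E where "E = {(u, v). u \<in> V \<and> v \<in> V \<and> u \<noteq> v \<and>
    (\<forall>z. inf_motion (parcs G) p z \<longrightarrow> (p u - p v) \<bullet> (z u - z v) = 0)}"
  \<comment> \<open>Passing to \<open>E\<close> loses no motion of \<open>G\<close>, which makes the
    closure itself closed.\<close>
  have motion_E: "inf_motion E p z" if "inf_motion (parcs G) p z" for z
    using that by (auto simp: E_def inf_motion_def)
  interpret closed_graph V p E
  proof
    fix u v assume "(u, v) \<in> E"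
    then have "u \<in> V" "v \<in> V" "u \<noteq> v" "\<And>z. inf_motion (parcs G) p z \<Longrightarrow> (p u - p v) \<bullet> (z u - z v) = 0"
      by (auto simp: E_def)
    moreover have "(p v - p u) \<bullet> (z v - z u) = (p u - p v) \<bullet> (z u - z v)" for z
      by (simp add: inner_diff_left inner_diff_right)
    ultimately show "(v, u) \<in> E"
      by (auto simp: E_def)
  next
    fix u v assume "u \<in> V" "v \<in> V" "u \<noteq> v" "\<And>z. inf_motion E p z \<Longrightarrow> (p u - p v) \<bullet> (z u - z v) = 0"
    then show "(u, v) \<in> E"
      using motion_E by (auto simp: E_def)
  qed (auto simp: E_def)
  have GE: "parcs G \<subseteq> E"
    using arcs G.pair_no_loops by (fastforce simp: E_def inf_motion_def)
  have "cut_connected ?k V"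
    unfolding cut_connected_def
  proof (intro conjI allI impI)
    show "?k < card V"
      using assms(2) by (simp add: k_connected_def V_def)
  next
    fix S A B assume *: "S \<subseteq> V" "card S < ?k" "A \<noteq> {}" "B \<noteq> {}" "A \<inter> B = {}" "A \<union> B = V - S"
    then have "Digraph_Component.connected (with_proj G \<restriction> (V - S))"
      using assms(2) unfolding k_connected_def V_def by blast
    then show "\<exists>a\<in>A. \<exists>b\<in>B. (a, b) \<in> E"
      using connected_imp_cut_edge[OF assms(1) _ *(3-6)] GE by blast
  qed
  then have "clique V"
    by (intro cut_connected_imp_clique) auto
  \<comment> \<open>Completeness of \<open>E\<close> means that every motion of \<open>G\<close>
    preserves all distances to first order.\<close>
  then have "(p u - p v) \<bullet> (z u - z v) = 0" if "inf_motion (parcs G) p z" "u \<in> V" "v \<in> V" for z u v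
    using that cliqueD[of V u v] by (cases "u = v") (auto simp: E_def)
  then have "rigid_framework G p"
    using arcs by (intro inf_rigid_imp_rigid) (auto simp: V_def)
  moreover have "generic_framework G p"
    using alg_indep by (simp add: generic_framework_def coords_def V_def)
  ultimately show ?thesis
    unfolding rigid_graph_def by blast
qed

end
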